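(* Let $K\subset\mathbb{R}^n$ be an $n$-dimensional convex polyhedron without bounded facets and whose recession cone $\vec{\mathcal C}(K)$ is $n$-dimensional. Then $\operatorname{Int}(K)$ is a polynomial image of $\mathbb{R}^n$.
   Context: A convex polyhedron $K\subset\mathbb{R}^n$ is a (nonempty) finite intersection of closed affine half-spaces. Its dimension is the dimension of the smallest affine subspace containing it, and $\operatorname{Int}(K)$ is its relative interior in that affine subspace. If $K$ is $n$-dimensional, there is a unique minimal family of affine hyperplanes $H_1,\dots,H_m$ such that $K=\bigcap_{i}H_i^+$ for suitable closed half-spaces $H_i^+$ bounded by $H_i$; the facets of $K$ are the sets $K\cap H_i$. The recession cone of $K$ is $\vec{\mathcal C}(K):=\{\vec v\in\mathbb{R}^n:\ p+\lambda\vec v\in K\ \text{for all}\ \lambda\ge 0\}$, where $p\in K$ is any point (the set does not depend on $p$). A map $f:\mathbb{R}^m\to\mathbb{R}^n$ is polynomial if all its components are polynomials with real coefficients, and a set $S\subset\mathbb{R}^n$ is a polynomial image of $\mathbb{R}^m$ if there is a polynomial map $f:\mathbb{R}^m\to\mathbb{R}^n$ with $f(\mathbb{R}^m)=S$. *)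

theory Defs
  imports "HOL-Analysis.Analysis"
begin

(* Polyhedra, facets, relative interiors and polynomial maps are the library's polyhedron,
   facet_of, rel_interior and polynomial_function. That the sets F with "F facet_of K" are
   exactly the intersections of K with the hyperplanes bounding an irredundant family of
   half-spaces that defines K is facet_of_polyhedron_explicit in HOL-Analysis.Polytope. *)

(* All base points are quantified over, so that the set depends on K alone; see
   recession_cone_base_point. The definition is meant for nonempty K only:
   recession_cone {} = UNIV. *)
definition recession_cone :: "'a::real_vector set \<Rightarrow> 'a set" where
  "recession_cone K = {v. \<forall>p\<in>K. \<forall>t\<ge>0. p + t *\<^sub>R v \<in> K}"

lemma recession_cone_base_point:
  fixes K :: "'a::real_normed_vector set"
  assumes "closed K" and "convex K" and p: "p \<in> K"
  shows "recession_cone K = {v. \<forall>t\<ge>0. p + t *\<^sub>R v \<in> K}"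
proof (intro equalityI subsetI CollectI)
  fix v assume "v \<in> {v. \<forall>t\<ge>0. p + t *\<^sub>R v \<in> K}"
  then have v: "p + t *\<^sub>R v \<in> K" if "t \<ge> 0" for t
    using that by blast
  have "q + t *\<^sub>R v \<in> K" if q: "q \<in> K" and t: "t \<ge> 0" for q t
  proof -
    define s where "s m = inverse (real (Suc m))" for m
    define X where "X m = (1 - s m) *\<^sub>R q + s m *\<^sub>R (p + (real (Suc m) * t) *\<^sub>R v)" for m
    have X: "X m \<in> K" for m
      unfolding X_def
    proof (rule convexD_alt[OF \<open>convex K\<close> q])
      show "p + (real (Suc m) * t) *\<^sub>R v \<in> K"
        using v t by simp
      show "0 \<le> s m" and "s m \<le> 1"
        by (simp_all add: s_def field_simps)
    qed
    have Xeq: "X m = (1 - s m) *\<^sub>R q + (s m *\<^sub>R p + t *\<^sub>R v)" for m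
    proof -
      have "s m * (real (Suc m) * t) = t"
        by (simp add: s_def field_simps)
      then show ?thesis
        by (simp add: X_def scaleR_add_right)
    qed
    have s0: "s \<longlonglongrightarrow> 0"
      unfolding s_def by (rule LIMSEQ_inverse_real_of_nat)
    have "(\<lambda>m. (1 - s m) *\<^sub>R q + (s m *\<^sub>R p + t *\<^sub>R v))
            \<longlonglongrightarrow> (1 - 0) *\<^sub>R q + (0 *\<^sub>R p + t *\<^sub>R v)"
      by (intro tendsto_intros s0)
    then have "X \<longlonglongrightarrow> q + t *\<^sub>R v"
      unfolding Xeq[abs_def] by simp
    with X show ?thesis
      using \<open>closed K\<close> closed_sequentially by blast
  qed
  then show "v \<in> recession_cone K"
    by (auto simp: recession_cone_def)
qed (use p in \<open>auto simp: recession_cone_def\<close>)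

end

theory Submission
  imports Defs
begin

text \<open>
Write the interior of \<open>K\<close> as the chamber of the points at which finitely many affine functions, the
slacks \<open>l\<^sub>i\<close> of the facets, are all positive. The full-dimensional recession cone yields a direction \<open>v\<close>
along which all slacks grow, and each unbounded facet yields a nonzero direction \<open>w\<^sub>i\<close> along which \<open>l\<^sub>i\<close> is
constant and no slack decreases.

All maps used move points along lines of one fixed direction \<open>w\<close>. Unless it lies in the chamber or misses it,
such a line meets the chamber in a ray, which begins at the maximum of the coordinates at which the line enters the half-spaces. This
maximum is not a polynomial. The function \<open>soft_max\<close> replaces it by a polynomial in one extra parameter
which always exceeds the maximum and takes values that come as close to it as a prescribed
polynomial rate demands.

Along the direction \<open>v\<close> this gives a polynomial map into the chamber that covers the core, the
points at which the product \<open>N\<close> of all slacks is not small (\<open>chamber_nearly_covered\<close>). The points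
near the boundary cannot be reached on lines in direction \<open>v\<close>, since a polynomial in one
variable has a closed range; they must come from infinity. Near the \<open>i\<close>-th facet they come from
infinity in direction \<open>w\<^sub>i\<close>: on a line in this direction with small constant value \<open>l\<^sub>i\<close>, the point with
\<open>N = 1\<close> is far away and belongs to the core, and at this point the product of the other slacks is
exactly \<open>1 / l\<^sub>i\<close>, a large quantity which is a polynomial. A self-map of the chamber can thus pull the
points with \<open>N\<close> near \<open>1\<close> back to the beginning of the ray with an error much smaller than \<open>l\<^sub>i\<close>
(\<open>pulling_map\<close>, \<open>facet_approached_from_infinity\<close>).

The pulling map of one facet must not destroy what the maps of other facets have achieved. Since its
displacement is divisible by every slack, it multiplies each slack by a polynomial; hence a
point close to the boundary has a preimage with the same slacks up to a polynomial factor, and the tolerances can be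
fixed one facet after the other, beginning with the map applied last
(\<open>chamber_without_line_is_polynomial_image\<close>). If the chamber contains a line, the product \<open>N\<close> may be
constant along \<open>w\<^sub>i\<close>; but then a single cubic map along that line reaches the missing points
(\<open>chamber_with_line_is_polynomial_image\<close>).
\<close>

section \<open>Polynomial functions\<close>

lemma abs_le_one_plus_square: "\<bar>x::real\<bar> \<le> 1 + x\<^sup>2"
  using zero_le_power2[of "\<bar>x\<bar> - 1"] by (simp add: power2_diff)

lemmas real_polynomial_function_intros =
  real_polynomial_function.intros(2-4) real_polynomial_function_diff real_polynomial_function_power
  real_polynomial_function_divide real_polynomial_function_sum real_polynomial_function_prod

text \<open>
Constants in the construction must dominate a polynomial at a point of which only the line and a bound
for the position on that line are known.
\<close>

lemma real_polynomial_function_majorant_on_segments: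
  fixes f :: "'a::real_normed_vector \<Rightarrow> real"
  assumes "real_polynomial_function f" and "real_polynomial_function T" and "\<And>p. 0 \<le> T p"
  shows "\<exists>h. real_polynomial_function h \<and> (\<forall>p t. \<bar>t\<bar> \<le> T p \<longrightarrow> \<bar>f (p + t *\<^sub>R w)\<bar> \<le> h p)"
  using assms(1)
proof induction
  case (linear f)
  have "\<bar>f (p + t *\<^sub>R w)\<bar> \<le> 1 + (f p)\<^sup>2 + T p * \<bar>f w\<bar>" if "\<bar>t\<bar> \<le> T p" for p t
  proof -
    have "f (p + t *\<^sub>R w) = f p + t * f w"
      using linear.hyps by (simp add: linear_simps)
    moreover have "\<bar>f p\<bar> \<le> 1 + (f p)\<^sup>2"
      by (rule abs_le_one_plus_square)
    moreover have "\<bar>t * f w\<bar> \<le> T p * \<bar>f w\<bar>"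
      unfolding abs_mult using that by (intro mult_right_mono) auto
    ultimately show ?thesis by linarith
  qed
  moreover have "real_polynomial_function (\<lambda>p. 1 + (f p)\<^sup>2 + T p * \<bar>f w\<bar>)"
    using assms(2) real_polynomial_function.intros(1)[OF linear.hyps]
    by (intro real_polynomial_function_intros)
  ultimately show ?case by blast
next
  case (const c)
  then show ?case by (intro exI[of _ "\<lambda>_. \<bar>c\<bar>"]) auto
next
  case (add f g)
  then obtain hf hg where "real_polynomial_function hf" "real_polynomial_function hg"
    and h: "\<And>p t. \<bar>t\<bar> \<le> T p \<Longrightarrow> \<bar>f (p + t *\<^sub>R w)\<bar> \<le> hf p" "\<And>p t. \<bar>t\<bar> \<le> T p \<Longrightarrow> \<bar>g (p + t *\<^sub>R w)\<bar> \<le> hg p"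
    by metis
  moreover have "\<bar>f (p + t *\<^sub>R w) + g (p + t *\<^sub>R w)\<bar> \<le> hf p + hg p" if "\<bar>t\<bar> \<le> T p" for p t
    using h[OF that] by linarith
  ultimately show ?case by (intro exI[of _ "\<lambda>p. hf p + hg p"]) auto
next
  case (mult f g)
  then obtain hf hg where "real_polynomial_function hf" "real_polynomial_function hg"
    and h: "\<And>p t. \<bar>t\<bar> \<le> T p \<Longrightarrow> \<bar>f (p + t *\<^sub>R w)\<bar> \<le> hf p" "\<And>p t. \<bar>t\<bar> \<le> T p \<Longrightarrow> \<bar>g (p + t *\<^sub>R w)\<bar> \<le> hg p"
    by metis
  moreover have "\<bar>f (p + t *\<^sub>R w) * g (p + t *\<^sub>R w)\<bar> \<le> hf p * hg p" if "\<bar>t\<bar> \<le> T p" for p t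
    unfolding abs_mult using h[OF that] by (intro mult_mono) auto
  ultimately show ?case by (intro exI[of _ "\<lambda>p. hf p * hg p"]) auto
qed

text \<open>
The coordinate along \<open>w\<close> in the orthogonal splitting of the space into the line of \<open>w\<close> and its
complement.
\<close>

definition coord :: "'a::real_inner \<Rightarrow> 'a \<Rightarrow> real" where
  "coord w p = (w \<bullet> p) / (w \<bullet> w)"

lemma coord_shift [simp]: "w \<noteq> 0 \<Longrightarrow> coord w (p + t *\<^sub>R w) = coord w p + t"
  by (simp add: coord_def inner_add_right add_divide_distrib)

lemma real_polynomial_function_inner: "real_polynomial_function (\<lambda>p. a \<bullet> p)"
  by (rule real_polynomial_function.intros(1)) (rule bounded_linear_inner_right)

lemma real_polynomial_function_coord: "real_polynomial_function (coord w)"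
  unfolding coord_def[abs_def]
  by (intro real_polynomial_function_intros real_polynomial_function_inner)

lemma polynomial_function_shift_along:
  assumes "real_polynomial_function f"
  shows "polynomial_function (\<lambda>p. p + f p *\<^sub>R (w::'a::real_normed_vector))"
  using assms unfolding real_polynomial_function_eq
  by (intro polynomial_function_add polynomial_function_id polynomial_function_mult
      polynomial_function_const)

lemma continuous_on_along_line:
  fixes f :: "'a::euclidean_space \<Rightarrow> real"
  assumes "real_polynomial_function f"
  shows "continuous_on X (\<lambda>x. f (p + (x - c) *\<^sub>R w))"
proof -
  have "continuous_on UNIV f"
    using assms by (auto simp: real_polynomial_function_eq intro: continuous_on_polymonial_function)
  then show ?thesis
    by (rule continuous_on_compose2) (auto intro!: continuous_intros)
qed

section \<open>A polynomial soft maximum\<close>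

text \<open>
A polynomial substitute for "raise \<open>s\<close> to the maximum of the list". Every step adds a square, so the
value only grows. With \<open>t\<close> already above the tail \<open>as\<close>, the square is at least \<open>1\<close> when \<open>t \<le> a\<close>, and
then the large factor \<open>A\<close> lifts the value over \<open>a\<close>; but it vanishes at the point slightly above
\<open>Max (a # as)\<close> where \<open>B\<close> times the product is \<open>1\<close>, so that values close to the maximum do occur. The
parameter \<open>A * B\<close> in the recursive call leaves room: where the tail comes that close to its own
maximum, the product for \<open>a # as\<close> is still at most \<open>1 / B\<close>.
\<close>

fun soft_max :: "real \<Rightarrow> real \<Rightarrow> real list \<Rightarrow> real \<Rightarrow> real" where
  "soft_max A B [] s = s"
| "soft_max A B (a # as) s =
    (let t = soft_max A (A * B) as s in t + A * (B * (\<Prod>c\<leftarrow>a # as. t - c) - 1)\<^sup>2)"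

lemma soft_max_ge:
  assumes "A \<ge> 0"
  shows "s \<le> soft_max A B as s"
proof (induction as arbitrary: B)
  case (Cons a as)
  have "s \<le> soft_max A (A * B) as s" by (rule Cons.IH)
  also have "\<dots> \<le> soft_max A B (a # as) s"
    using assms by (simp add: Let_def)
  finally show ?case .
qed simp

lemma prod_list_pos_real:
  fixes f :: "'a \<Rightarrow> real"
  assumes "\<And>c. c \<in> set cs \<Longrightarrow> 0 < f c"
  shows "0 < (\<Prod>c\<leftarrow>cs. f c)"
  using assms by (induction cs) auto

lemma power_le_prod_list:
  fixes f :: "'a \<Rightarrow> real"
  assumes "\<And>c. c \<in> set cs \<Longrightarrow> x \<le> f c" and "0 \<le> x"
  shows "x ^ length cs \<le> (\<Prod>c\<leftarrow>cs. f c)"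
  using assms
proof (induction cs)
  case (Cons c cs)
  then have "x * x ^ length cs \<le> f c * (\<Prod>c\<leftarrow>cs. f c)"
    by (intro mult_mono) (auto intro: order_trans)
  then show ?case by simp
qed simp

lemma exists_small_factor:
  fixes f :: "'a \<Rightarrow> real"
  assumes "(\<Prod>c\<leftarrow>cs. f c) \<le> x ^ length cs" and "cs \<noteq> []" and "0 < x"
  shows "\<exists>c\<in>set cs. f c \<le> x"
proof (rule ccontr)
  assume "\<not> ?thesis"
  then have big: "x < f c" if "c \<in> set cs" for c
    using that by force
  obtain c ds where cs: "cs = c # ds" using assms(2) by (cases cs) auto
  have "x ^ length ds \<le> (\<Prod>c\<leftarrow>ds. f c)"
    using big assms(3) by (intro power_le_prod_list) (auto simp: cs less_imp_le)
  moreover have "0 < x ^ length ds" using assms(3) by simp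
  moreover have "x < f c" using big cs by simp
  ultimately have "x * x ^ length ds < f c * (\<Prod>c\<leftarrow>ds. f c)"
    using assms(3) by (intro mult_less_le_imp_less) auto
  then show False using assms(1) by (simp add: cs)
qed

lemma soft_max_greater:
  assumes "\<And>c. c \<in> set as \<Longrightarrow> \<bar>c\<bar> \<le> R" and "- R \<le> s" and "0 \<le> R" and "0 \<le> B" and "c \<in> set as"
  shows "c < soft_max (2 * R + 1) B as s"
  using assms
proof (induction as arbitrary: B c)
  case (Cons a as)
  define A where "A = 2 * R + 1"
  define t where "t = soft_max A (A * B) as s"
  define P where "P = (\<Prod>c\<leftarrow>as. t - c)"
  have A: "A \<ge> 0" using Cons.prems by (simp add: A_def)
  have AB: "0 \<le> A * B" using A Cons.prems by simp
  have tail: "c < t" if "c \<in> set as" for c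
    using Cons.IH[of "A * B" c] that Cons.prems AB by (auto simp: t_def A_def)
  have P: "0 < P"
    unfolding P_def using tail by (intro prod_list_pos_real) simp
  have eq: "soft_max A B (a # as) s = t + A * (B * ((t - a) * P) - 1)\<^sup>2"
    by (simp add: Let_def t_def P_def)
  have ge: "t \<le> soft_max A B (a # as) s"
    unfolding eq using A by simp
  have head: "a < soft_max A B (a # as) s"
  proof (cases "a < t")
    case False
    then have "B * ((t - a) * P) \<le> 0"
      using P Cons.prems(4) by (intro mult_nonneg_nonpos mult_nonpos_nonneg) auto
    then have "1 \<le> (B * ((t - a) * P) - 1)\<^sup>2"
      using abs_le_square_iff[of 1 "B * ((t - a) * P) - 1"] by simp
    then have "A * 1 \<le> A * (B * ((t - a) * P) - 1)\<^sup>2"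
      using A by (intro mult_left_mono)
    moreover have "- R \<le> t"
      using Cons.prems(2) soft_max_ge[OF A, of s "A * B" as] by (simp add: t_def)
    moreover have "a \<le> R" using Cons.prems(1)[of a] by simp
    ultimately show ?thesis unfolding eq by (simp add: A_def)
  qed (use ge in simp)
  show ?case
    using head ge tail Cons.prems(5) by (fold A_def) fastforce
qed simp

lemma continuous_on_soft_max:
  fixes s B :: "'a::topological_space \<Rightarrow> real"
  assumes "continuous_on X s" "continuous_on X B"
  shows "continuous_on X (\<lambda>x. soft_max A (B x) as (s x))"
  using assms
proof (induction as arbitrary: B)
  case (Cons a as)
  have t: "continuous_on X (\<lambda>x. soft_max A (A * B x) as (s x))"
    using Cons by (intro Cons.IH continuous_intros)
  have "continuous_on X (\<lambda>x. \<Prod>c\<leftarrow>cs. soft_max A (A * B x) as (s x) - c)" for cs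
    by (induction cs) (auto intro!: continuous_intros t)
  then show ?case
    using t Cons.prems by (auto simp only: soft_max.simps Let_def intro!: continuous_intros)
qed simp

text \<open>
The converse to \<open>soft_max_greater\<close>: if \<open>s\<close> runs from below all entries to above them, then the soft
maximum comes as near to the true maximum as \<open>B\<close> prescribes. By induction there is a point where the
square in the outermost step has a base that is not positive; at \<open>v\<close> it
is not negative, and at a zero in between the outermost step changes nothing.
\<close>

lemma soft_max_attains:
  fixes s B :: "real \<Rightarrow> real"
  assumes "\<And>c. c \<in> set as \<Longrightarrow> \<bar>c\<bar> \<le> R" and "0 \<le> R" and "as \<noteq> []" and "u \<le> v"
    and "continuous_on {u..v} s" and "continuous_on {u..v} B"
    and "\<And>x. x \<in> {u..v} \<Longrightarrow> 1 \<le> B x" and "\<And>x. x \<in> {u..v} \<Longrightarrow> - R \<le> s x"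
    and "s u \<le> - R" and "R + 1 \<le> s v"
  shows "\<exists>y\<in>{u..v}. (\<Prod>c\<leftarrow>as. soft_max (2 * R + 1) (B y) as (s y) - c) = 1 / B y"
  using assms(1,3,6,7)
proof (induction as arbitrary: B)
  case (Cons a as)
  define A where "A = 2 * R + 1"
  have A: "1 \<le> A" using assms(2) by (simp add: A_def)
  define t where "t x = soft_max A (A * B x) as (s x)" for x
  define h where "h x = B x * (\<Prod>c\<leftarrow>a # as. t x - c)" for x
  have AB: "1 \<le> A * B x" if "x \<in> {u..v}" for x
    using mult_mono[OF A Cons.prems(4)[OF that]] A by simp
  have contAB: "continuous_on {u..v} (\<lambda>x. A * B x)"
    by (intro continuous_intros Cons.prems)
  have cont_t: "continuous_on {u..v} t"
    unfolding t_def by (intro continuous_on_soft_max contAB assms)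
  have "continuous_on {u..v} (\<lambda>x. \<Prod>c\<leftarrow>cs. t x - c)" for cs
    by (induction cs) (auto intro!: continuous_intros cont_t)
  then have cont_h: "continuous_on {u..v} h"
    unfolding h_def by (intro continuous_intros Cons.prems)
  have start: "\<exists>y\<in>{u..v}. h y \<le> 1"
  proof (cases "as = []")
    case True
    have "B u * (s u - a) \<le> 0"
      using Cons.prems(1)[of a] Cons.prems(4)[of u] assms(4,9) by (intro mult_nonneg_nonpos) auto
    then have "h u \<le> 1" by (simp add: h_def t_def True)
    then show ?thesis using assms(4) by auto
  next
    case False
    obtain y where y: "y \<in> {u..v}" and eq: "(\<Prod>c\<leftarrow>as. t y - c) = 1 / (A * B y)"
      using Cons.IH[of "\<lambda>x. A * B x"] False Cons.prems contAB AB
      unfolding t_def A_def by auto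
    \<comment> \<open>Some factor is at most 1, which bounds \<open>t y\<close> and hence the new factor \<open>t y - a\<close> by \<open>A\<close>.\<close>
    have "1 / (A * B y) \<le> 1" using AB[OF y] by simp
    then have "\<exists>c\<in>set as. t y - c \<le> 1"
      using False by (intro exists_small_factor) (auto simp: eq)
    then obtain c where "c \<in> set as" "t y - c \<le> 1" by auto
    then have "t y \<le> R + 1" using Cons.prems(1)[of c] by auto
    then have "t y - a \<le> A" using Cons.prems(1)[of a] by (auto simp: A_def)
    moreover have "h y = (t y - a) / A"
      using Cons.prems(4)[OF y] A by (simp add: h_def eq field_simps)
    ultimately have "h y \<le> 1" using A by simp
    then show ?thesis using y by blast
  qed
  then obtain y where y: "y \<in> {u..v}" "h y \<le> 1" by blast
  have v: "v \<in> {u..v}" using assms(4) by simp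
  have "R + 1 \<le> t v"
    using assms(10) soft_max_ge[of A "s v" "A * B v" as] A by (simp add: t_def)
  then have "1 \<le> (\<Prod>c\<leftarrow>a # as. t v - c)"
    using Cons.prems(1) power_le_prod_list[of "a # as" 1 "\<lambda>c. t v - c"] by force
  then have "1 \<le> h v"
    using mult_mono[of 1 "B v" 1 "\<Prod>c\<leftarrow>a # as. t v - c"] Cons.prems(4)[OF v] by (simp add: h_def)
  moreover have "continuous_on {y..v} h"
    using cont_h y by (rule_tac continuous_on_subset) auto
  ultimately obtain x where x: "y \<le> x" "x \<le> v" "h x = 1"
    using IVT'[of h y 1 v] y by auto
  then have xuv: "x \<in> {u..v}" using y by simp
  have "soft_max A (B x) (a # as) (s x) = t x"
    using x(3) by (simp add: Let_def t_def h_def)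
  moreover have "(\<Prod>c\<leftarrow>a # as. t x - c) = 1 / B x"
    using x(3) Cons.prems(4)[OF xuv] by (simp add: h_def field_simps)
  ultimately show ?case using xuv by (metis A_def)
qed simp

lemma real_polynomial_function_soft_max:
  assumes "real_polynomial_function A" "real_polynomial_function B" "real_polynomial_function s"
    and "\<And>j. j \<in> set js \<Longrightarrow> real_polynomial_function (a j)"
  shows "real_polynomial_function (\<lambda>p. soft_max (A p) (B p) (map (\<lambda>j. a j p) js) (s p))"
  using assms
proof (induction js arbitrary: B)
  case (Cons i js)
  define t where "t p = soft_max (A p) (A p * B p) (map (\<lambda>j. a j p) js) (s p)" for p
  have t: "real_polynomial_function t"
    unfolding t_def using Cons by auto
  have "real_polynomial_function (\<lambda>p. \<Prod>c\<leftarrow>map (\<lambda>j. a j p) ks. t p - c)"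
    if "\<And>j. j \<in> set ks \<Longrightarrow> real_polynomial_function (a j)" for ks
    using that
  proof (induction ks)
    case (Cons k ks)
    then have "real_polynomial_function (\<lambda>p. (t p - a k p) * (\<Prod>c\<leftarrow>map (\<lambda>j. a j p) ks. t p - c))"
      using t by (intro real_polynomial_function_intros) auto
    then show ?case by simp
  qed auto
  from this[of "i # js"]
  have "real_polynomial_function (\<lambda>p. \<Prod>c\<leftarrow>map (\<lambda>j. a j p) (i # js). t p - c)"
    using Cons.prems by auto
  then have "real_polynomial_function (\<lambda>p. t p + A p *
      (B p * (\<Prod>c\<leftarrow>map (\<lambda>j. a j p) (i # js). t p - c) - 1)\<^sup>2)"
    using t Cons.prems by (intro real_polynomial_function_intros)
  then show ?case
    by (simp only: soft_max.simps list.map Let_def t_def)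
qed auto

section \<open>Chambers of linear inequalities\<close>

locale linear_inequalities =
  fixes I :: "'i set" and g :: "'i \<Rightarrow> 'a::euclidean_space" and b :: "'i \<Rightarrow> real"
  assumes finite_I: "finite I"
begin

definition slack :: "'i \<Rightarrow> 'a \<Rightarrow> real" where
  "slack i p = g i \<bullet> p + b i"

definition chamber :: "'a set" where
  "chamber = {p. \<forall>i\<in>I. 0 < slack i p}"

definition slack_prod :: "'a \<Rightarrow> real" where
  "slack_prod p = (\<Prod>i\<in>I. slack i p)"

definition crossings :: "'a \<Rightarrow> 'i set" where
  "crossings w = {j \<in> I. 0 < g j \<bullet> w}"

text \<open>
When \<open>w\<close> leads out of no half-space, a line in direction \<open>w\<close> that meets the chamber is inside
as soon as its coordinate exceeds the coordinates \<open>entry w j p\<close> at which it crosses the hyperplanes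
that are not parallel to \<open>w\<close>. These numbers, the bound \<open>entry_bound\<close> for them, and \<open>soft_coord\<close> up to its
explicit arguments depend on the line only.
\<close>

definition entry :: "'a \<Rightarrow> 'i \<Rightarrow> 'a \<Rightarrow> real" where
  "entry w j p = coord w p - slack j p / (g j \<bullet> w)"

definition entry_bound :: "'a \<Rightarrow> 'a \<Rightarrow> real" where
  "entry_bound w p = 1 + (\<Sum>j\<in>crossings w. (entry w j p)\<^sup>2)"

definition soft_coord :: "'a \<Rightarrow> 'i list \<Rightarrow> 'a \<Rightarrow> real \<Rightarrow> real \<Rightarrow> real" where
  "soft_coord w js p B \<tau> =
    soft_max (2 * entry_bound w p + 1) B (map (\<lambda>j. entry w j p) js) (\<tau>\<^sup>2 - entry_bound w p)"

lemma finite_crossings: "finite (crossings w)"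
  using finite_I by (simp add: crossings_def)

lemma crossings_subset: "crossings w \<subseteq> I"
  by (auto simp: crossings_def)

lemma crossingsD: "j \<in> crossings w \<Longrightarrow> j \<in> I" "j \<in> crossings w \<Longrightarrow> 0 < g j \<bullet> w"
  by (auto simp: crossings_def)

lemma slack_shift: "slack j (p + t *\<^sub>R w) = slack j p + t * (g j \<bullet> w)"
  by (simp add: slack_def inner_add_right)

lemma entry_shift:
  "\<lbrakk>w \<noteq> 0; j \<in> crossings w\<rbrakk> \<Longrightarrow> entry w j (p + t *\<^sub>R w) = entry w j p"
  using crossingsD(2)[of j w] by (simp add: entry_def slack_shift add_divide_distrib)

lemma entry_bound_shift: "w \<noteq> 0 \<Longrightarrow> entry_bound w (p + t *\<^sub>R w) = entry_bound w p"
  by (simp add: entry_bound_def entry_shift cong: sum.cong)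

lemma soft_coord_shift:
  assumes "w \<noteq> 0" and "set js \<subseteq> crossings w"
  shows "soft_coord w js (p + t *\<^sub>R w) B \<tau> = soft_coord w js p B \<tau>"
proof -
  have "map (\<lambda>j. entry w j (p + t *\<^sub>R w)) js = map (\<lambda>j. entry w j p) js"
    using assms by (auto simp: entry_shift)
  then show ?thesis
    by (simp only: soft_coord_def entry_bound_shift[OF assms(1)])
qed

lemma slack_entry: "j \<in> crossings w \<Longrightarrow> slack j p = (g j \<bullet> w) * (coord w p - entry w j p)"
  using crossingsD(2)[of j w] by (simp add: entry_def)

lemma entry_less_coord:
  "\<lbrakk>p \<in> chamber; j \<in> crossings w\<rbrakk> \<Longrightarrow> entry w j p < coord w p"
  using crossingsD[of j w] by (simp add: entry_def chamber_def)

lemma one_le_entry_bound: "1 \<le> entry_bound w p"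
  by (simp add: entry_bound_def sum_nonneg)

lemma abs_entry_le:
  assumes "j \<in> crossings w"
  shows "\<bar>entry w j p\<bar> \<le> entry_bound w p"
proof -
  have "(entry w j p)\<^sup>2 \<le> (\<Sum>j\<in>crossings w. (entry w j p)\<^sup>2)"
    using assms finite_crossings by (intro member_le_sum) auto
  then show ?thesis
    using abs_le_one_plus_square[of "entry w j p"] by (simp add: entry_bound_def)
qed

lemma chamber_on_line:
  assumes "\<And>i. i \<in> I \<Longrightarrow> 0 \<le> g i \<bullet> w" and "w \<noteq> 0" and "p \<in> chamber"
    and "\<And>j. j \<in> crossings w \<Longrightarrow> entry w j p < x"
  shows "p + (x - coord w p) *\<^sub>R w \<in> chamber"
  unfolding chamber_def
proof (intro CollectI ballI)
  fix i assume i: "i \<in> I"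
  show "0 < slack i (p + (x - coord w p) *\<^sub>R w)"
  proof (cases "i \<in> crossings w")
    case True
    then show ?thesis
      using assms(2,4) crossingsD(2)[OF True] by (subst slack_entry[of _ w]) (auto simp: entry_shift)
  next
    case False
    then have "g i \<bullet> w = 0" using assms(1)[OF i] i by (auto simp: crossings_def)
    then show ?thesis using assms(3) i by (simp add: slack_shift chamber_def)
  qed
qed

lemma slack_prod_pos: "p \<in> chamber \<Longrightarrow> 0 < slack_prod p"
  by (auto simp: slack_prod_def chamber_def intro: prod_pos)

lemma soft_coord_greater:
  assumes "set js = crossings w" "0 \<le> B" "j \<in> crossings w"
  shows "entry w j p < soft_coord w js p B \<tau>"
  unfolding soft_coord_def
  using assms abs_entry_le[of _ w p] one_le_entry_bound[of w p]
  by (intro soft_max_greater) auto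

lemma soft_coord_ge: "\<tau>\<^sup>2 - entry_bound w p \<le> soft_coord w js p B \<tau>"
  unfolding soft_coord_def using one_le_entry_bound[of w p] by (intro soft_max_ge) auto

lemma real_polynomial_function_slack: "real_polynomial_function (slack j)"
  unfolding slack_def[abs_def]
  by (intro real_polynomial_function_intros real_polynomial_function_inner)

lemma real_polynomial_function_slack_prod: "real_polynomial_function slack_prod"
  unfolding slack_prod_def[abs_def]
  by (intro real_polynomial_function_intros real_polynomial_function_slack finite_I)

lemma real_polynomial_function_entry: "real_polynomial_function (entry w j)"
  unfolding entry_def[abs_def]
  by (intro real_polynomial_function_intros real_polynomial_function_slack
      real_polynomial_function_coord)

lemma real_polynomial_function_entry_bound: "real_polynomial_function (entry_bound w)"
  unfolding entry_bound_def[abs_def]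
  by (intro real_polynomial_function_intros real_polynomial_function_entry finite_crossings)

lemma real_polynomial_function_soft_coord:
  assumes "real_polynomial_function B" "real_polynomial_function \<tau>"
  shows "real_polynomial_function (\<lambda>p. soft_coord w js p (B p) (\<tau> p))"
  unfolding soft_coord_def
  by (intro real_polynomial_function_soft_max real_polynomial_function_intros assms
      real_polynomial_function_entry real_polynomial_function_entry_bound)

lemma soft_coord_attains:
  fixes \<tau> B :: "real \<Rightarrow> real"
  assumes "set js = crossings w" and "crossings w \<noteq> {}" and "u \<le> v"
    and "continuous_on {u..v} \<tau>" "continuous_on {u..v} B" "\<And>x. x \<in> {u..v} \<Longrightarrow> 1 \<le> B x"
    and "\<tau> u = 0" and "2 * entry_bound w p + 1 \<le> (\<tau> v)\<^sup>2"
  obtains y where "y \<in> {u..v}" and "(\<Prod>j\<leftarrow>js. soft_coord w js p (B y) (\<tau> y) - entry w j p) = 1 / B y"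
proof -
  let ?R = "entry_bound w p"
  have "\<exists>y\<in>{u..v}. (\<Prod>c\<leftarrow>map (\<lambda>j. entry w j p) js.
      soft_max (2 * ?R + 1) (B y) (map (\<lambda>j. entry w j p) js) ((\<tau> y)\<^sup>2 - ?R) - c) = 1 / B y"
  proof (rule soft_max_attains)
    show "continuous_on {u..v} (\<lambda>y. (\<tau> y)\<^sup>2 - ?R)"
      by (intro continuous_intros assms)
  qed (use assms one_le_entry_bound[of w p] abs_entry_le[of _ w p] in auto)
  then show ?thesis
    using that by (auto simp: soft_coord_def o_def)
qed

section \<open>Covering the core\<close>

text \<open>
Moving every point in direction \<open>v\<close> to the soft maximum of the entries of its line, with
the square of the coordinate as free parameter, lands in the chamber; the lower end of the image of each line is where the product of the slacks is at most \<open>1 / E\<close>. Hence everything is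
reached except points close to the boundary, where closeness can be prescribed by any polynomial \<open>E\<close>
that is constant along \<open>v\<close>.
\<close>

lemma chamber_nearly_covered:
  assumes v: "\<And>i. i \<in> I \<Longrightarrow> 0 < g i \<bullet> v" and "I \<noteq> {}"
    and E: "real_polynomial_function E" "\<And>p. 1 \<le> E p" "\<And>p t. E (p + t *\<^sub>R v) = E p"
  obtains f :: "'a \<Rightarrow> 'a" where "polynomial_function f" and "range f \<subseteq> chamber"
    and "\<And>q. \<lbrakk>q \<in> chamber; 1 \<le> E q * slack_prod q\<rbrakk> \<Longrightarrow> q \<in> range f"
proof -
  have v0: "v \<noteq> 0" using v \<open>I \<noteq> {}\<close> by force
  have cross: "crossings v = I" using v by (auto simp: crossings_def)
  obtain js where js: "set js = I" "distinct js" using finite_distinct_list[OF finite_I] by blast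
  define \<Lambda> where "\<Lambda> = (\<Prod>i\<in>I. g i \<bullet> v)"
  have \<Lambda>: "0 < \<Lambda>" unfolding \<Lambda>_def using v by (intro prod_pos) auto
  define B where "B p = E p * (1 + \<Lambda>)" for p
  have B1: "1 \<le> B p" for p
    unfolding B_def using mult_mono[of 1 "E p" 1 "1 + \<Lambda>"] E(2)[of p] \<Lambda> by simp
  define s where "s p = soft_coord v js p (B p) (coord v p)" for p
  define f where "f p = p + (s p - coord v p) *\<^sub>R v" for p
  have poly_B: "real_polynomial_function B"
    unfolding B_def[abs_def] by (intro real_polynomial_function_intros E)
  have poly_s: "real_polynomial_function s"
    unfolding s_def[abs_def]
    by (intro real_polynomial_function_soft_coord real_polynomial_function_coord poly_B)
  have "polynomial_function f"
    unfolding f_def[abs_def]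
    by (intro polynomial_function_shift_along real_polynomial_function_intros poly_s
        real_polynomial_function_coord)
  moreover have "range f \<subseteq> chamber"
  proof clarify
    fix p
    have "0 < slack i (f p)" if "i \<in> I" for i
    proof -
      have i: "i \<in> crossings v" using that cross by simp
      have "entry v i p < s p"
        unfolding s_def using soft_coord_greater js cross B1[of p] that by simp
      then show ?thesis
        using v[OF that] v0 i by (subst slack_entry[OF i]) (auto simp: f_def entry_shift)
    qed
    then show "f p \<in> chamber" by (simp add: chamber_def)
  qed
  moreover have "q \<in> range f" if q: "q \<in> chamber" "1 \<le> E q * slack_prod q" for q
  proof -
    let ?R = "entry_bound v q" and ?S = "\<lambda>x. soft_coord v js q (B q) x"
    define l where "l x = q + (x - coord v q) *\<^sub>R v" for x
    have R: "1 \<le> ?R" by (rule one_le_entry_bound)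
    have cont: "continuous_on X ?S" for X
      unfolding soft_coord_def by (intro continuous_on_soft_max continuous_intros)
    obtain y where y: "y \<in> {0..2 * ?R + 1}" and y_eq: "(\<Prod>j\<leftarrow>js. ?S y - entry v j q) = 1 / B q"
    proof (rule soft_coord_attains[of js v 0 "2 * ?R + 1" "\<lambda>x. x" "\<lambda>_. B q" q])
      show "2 * ?R + 1 \<le> (2 * ?R + 1)\<^sup>2"
        unfolding power2_eq_square using R by (simp add: algebra_simps)
    qed (use js cross \<open>I \<noteq> {}\<close> R B1 in auto)
    have Sy: "?S y \<le> coord v q"
    proof (rule ccontr)
      assume less: "\<not> ?thesis"
      have "slack_prod q = (\<Prod>i\<in>I. (g i \<bullet> v) * (coord v q - entry v i q))"
        unfolding slack_prod_def using cross by (intro prod.cong refl slack_entry) auto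
      also have "\<dots> \<le> (\<Prod>i\<in>I. (g i \<bullet> v) * (?S y - entry v i q))"
        using less cross entry_less_coord[OF q(1), of _ v] v
        by (intro prod_mono conjI mult_left_mono mult_nonneg_nonneg) (auto simp: less_imp_le)
      also have "\<dots> = \<Lambda> * (\<Prod>j\<leftarrow>js. ?S y - entry v j q)"
        using prod.distinct_set_conv_list[OF js(2), of "\<lambda>i. ?S y - entry v i q"]
        by (simp add: prod.distrib \<Lambda>_def js(1))
      also have "\<dots> = \<Lambda> / (E q * (1 + \<Lambda>))" by (simp only: y_eq) (simp add: B_def)
      finally have "E q * slack_prod q \<le> E q * (\<Lambda> / (E q * (1 + \<Lambda>)))"
        using E(2)[of q] by (intro mult_left_mono) auto
      also have "\<dots> = \<Lambda> / (1 + \<Lambda>)" using E(2)[of q] by auto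
      also have "\<dots> < 1" using \<Lambda> by simp
      finally show False using q(2) by simp
    qed
    define Y where "Y = y + \<bar>coord v q\<bar> + ?R + 1"
    have "Y * 1 \<le> Y\<^sup>2"
      unfolding power2_eq_square Y_def using y R by (intro mult_left_mono) auto
    moreover have "0 \<le> y" using y by simp
    then have "coord v q + ?R \<le> Y" unfolding Y_def by linarith
    ultimately have "coord v q \<le> Y\<^sup>2 - ?R" by linarith
    then have "coord v q \<le> ?S Y"
      using soft_coord_ge[of Y v q js "B q"] by simp
    moreover have "y \<le> Y" using R by (simp add: Y_def)
    ultimately obtain x where x: "?S x = coord v q"
      using IVT'[of ?S y "coord v q" Y, OF Sy _ _ cont] by blast
    have "s (l x) = ?S x"
      unfolding s_def l_def using v0 js cross
      by (simp add: soft_coord_shift B_def E(3))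
    then have "f (l x) = q"
      using v0 x by (simp add: f_def l_def flip: scaleR_add_left)
    then show ?thesis by (metis rangeI)
  qed
  ultimately show ?thesis by (rule that)
qed

section \<open>Chambers that contain a line\<close>

text \<open>
If the chamber is invariant under translation by \<open>u\<close>, a single polynomial map suffices to reach the missing points.
After making \<open>v\<close> orthogonal to \<open>u\<close>, the factor \<open>E = 1 + (coord u)\<^sup>2\<close> is admissible, so
the points far out on a line in direction \<open>u\<close> are already covered, namely those with coordinate
\<open>x\<close> satisfying \<open>x\<^sup>2 n \<ge> 1\<close>, where \<open>n\<close> is the product of the slacks, a constant of the line. The cubic
\<open>x (x\<^sup>2 n - 2)\<close> vanishes at \<open>x\<^sup>2 n = 2\<close>, hence maps these far points onto the whole line.
\<close>

lemma chamber_with_line_is_polynomial_image: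
  assumes v: "\<And>i. i \<in> I \<Longrightarrow> 0 < g i \<bullet> v" and "I \<noteq> {}"
    and u: "u \<noteq> 0" "\<And>i. i \<in> I \<Longrightarrow> g i \<bullet> u = 0"
  shows "\<exists>f :: 'a \<Rightarrow> 'a. polynomial_function f \<and> range f = chamber"
proof -
  define v' where "v' = v - coord u v *\<^sub>R u"
  have v': "0 < g i \<bullet> v'" if "i \<in> I" for i
    using v[OF that] u(2)[OF that] by (simp add: v'_def inner_diff_right)
  have "u \<bullet> v' = 0" using u(1) by (simp add: v'_def coord_def inner_diff_right)
  then have coord_v': "coord u (p + t *\<^sub>R v') = coord u p" for p t
    by (simp add: coord_def inner_add_right)
  define E where "E p = 1 + (coord u p)\<^sup>2" for p
  have E: "real_polynomial_function E"
    unfolding E_def[abs_def] by (intro real_polynomial_function_intros real_polynomial_function_coord)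
  obtain f :: "'a \<Rightarrow> 'a" where f: "polynomial_function f" "range f \<subseteq> chamber"
    "\<And>q. \<lbrakk>q \<in> chamber; 1 \<le> E q * slack_prod q\<rbrakk> \<Longrightarrow> q \<in> range f"
    using chamber_nearly_covered[OF v' \<open>I \<noteq> {}\<close> E] by (auto simp: E_def coord_v')
  define \<psi> where "\<psi> n x = x * (x\<^sup>2 * n - 2)" for n x :: real
  define h where "h p = p + (\<psi> (slack_prod p) (coord u p) - coord u p) *\<^sub>R u" for p
  have poly_h: "polynomial_function h"
    unfolding h_def[abs_def] \<psi>_def
    by (intro polynomial_function_shift_along real_polynomial_function_intros
        real_polynomial_function_coord real_polynomial_function_slack_prod)
  have slack_u: "slack i (p + t *\<^sub>R u) = slack i p" if "i \<in> I" for i p t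
    using u(2)[OF that] by (simp add: slack_shift)
  have shift_u: "slack_prod (p + t *\<^sub>R u) = slack_prod p" "p + t *\<^sub>R u \<in> chamber \<longleftrightarrow> p \<in> chamber" for p t
    by (auto simp: slack_prod_def chamber_def slack_u intro: prod.cong)
  have reach: "\<exists>x. \<psi> n x = c \<and> 1 \<le> x\<^sup>2 * n" if n: "0 < n" and c: "0 \<le> c" for n c
  proof -
    define r where "r k = sqrt (k / n)" for k
    have r: "0 \<le> r k" "(r k)\<^sup>2 * n = k" if "0 \<le> k" for k
      using that n by (auto simp: r_def)
    have "r 2 \<le> r 3" using n by (simp add: r_def divide_right_mono)
    have "(r 3)\<^sup>2 * n \<le> (r 3 + c)\<^sup>2 * n"
      using n c r(1)[of 3] by (intro mult_right_mono power_mono) auto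
    then have "(r 3 + c) * 1 \<le> \<psi> n (r 3 + c)"
      unfolding \<psi>_def using r[of 3] c by (intro mult_left_mono) auto
    moreover have "\<psi> n (r 2) = 0" using r(2)[of 2] by (simp add: \<psi>_def)
    moreover have "continuous_on X (\<psi> n)" for X
      unfolding \<psi>_def by (intro continuous_intros)
    ultimately obtain x where x: "r 2 \<le> x" "\<psi> n x = c"
      using IVT'[of "\<psi> n" "r 2" c "r 3 + c"] \<open>r 2 \<le> r 3\<close> c r(1)[of 3] by auto
    have "(r 2)\<^sup>2 * n \<le> x\<^sup>2 * n"
      using n x(1) r(1)[of 2] by (intro mult_right_mono power_mono) auto
    then show ?thesis using x(2) r(2)[of 2] by auto
  qed
  have "range (h \<circ> f) = chamber"
  proof (intro equalityI subsetI)
    fix q assume "q \<in> range (h \<circ> f)"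
    then show "q \<in> chamber" using f(2) by (auto simp: h_def shift_u)
  next
    fix q assume q: "q \<in> chamber"
    obtain x where x: "\<psi> (slack_prod q) x = coord u q" "1 \<le> x\<^sup>2 * slack_prod q"
    proof (cases "0 \<le> coord u q")
      case True
      then show ?thesis using reach[OF slack_prod_pos[OF q]] that by blast
    next
      case False
      then obtain x where "\<psi> (slack_prod q) x = - coord u q" "1 \<le> x\<^sup>2 * slack_prod q"
        using reach[OF slack_prod_pos[OF q], of "- coord u q"] by auto
      then show ?thesis using that[of "- x"] by (simp add: \<psi>_def)
    qed
    define p where "p = q + (x - coord u q) *\<^sub>R u"
    have "coord u p = x" using u(1) by (simp add: p_def)
    moreover have "slack_prod p = slack_prod q" unfolding p_def by (rule shift_u(1))
    ultimately have "1 \<le> E p * slack_prod p"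
      using x(2) slack_prod_pos[OF q] by (simp add: E_def distrib_right)
    then have "p \<in> range f" using q by (intro f(3)) (auto simp: p_def shift_u)
    moreover have "h p = q"
      using x(1) u(1) by (simp add: h_def p_def shift_u flip: scaleR_add_left)
    ultimately show "q \<in> range (h \<circ> f)" by (metis comp_apply imageE rangeI)
  qed
  then show ?thesis using polynomial_function_compose[OF f(1) poly_h] by blast
qed

section \<open>Pulling points back from infinity\<close>

definition cofactor :: "'i \<Rightarrow> 'a \<Rightarrow> real" where
  "cofactor j p = (\<Prod>k\<in>I - {j}. slack k p)"

lemma slack_prod_cofactor: "j \<in> I \<Longrightarrow> slack_prod p = slack j p * cofactor j p"
  using finite_I by (simp add: slack_prod_def cofactor_def prod.remove)

lemma cofactor_pos: "p \<in> chamber \<Longrightarrow> 0 < cofactor j p"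
  by (auto simp: cofactor_def chamber_def intro: prod_pos)

lemma real_polynomial_function_cofactor: "real_polynomial_function (cofactor j)"
  unfolding cofactor_def[abs_def] using finite_I
  by (intro real_polynomial_function_intros real_polynomial_function_slack) auto

lemma cofactor_mono:
  assumes "p \<in> chamber" "\<And>i. i \<in> I \<Longrightarrow> 0 \<le> g i \<bullet> w" "0 \<le> t"
  shows "cofactor j p \<le> cofactor j (p + t *\<^sub>R w)"
  unfolding cofactor_def using assms by (intro prod_mono) (auto simp: slack_shift chamber_def less_imp_le)

lemma slack_prod_mono:
  assumes "p \<in> chamber" "\<And>i. i \<in> I \<Longrightarrow> 0 \<le> g i \<bullet> w" "0 \<le> t"
  shows "slack_prod p \<le> slack_prod (p + t *\<^sub>R w)"
  unfolding slack_prod_def using assms by (intro prod_mono) (auto simp: slack_shift chamber_def less_imp_le)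

lemma last_entry:
  assumes "crossings w \<noteq> {}"
  shows "\<exists>j\<in>crossings w. \<forall>k\<in>crossings w. entry w k p \<le> entry w j p"
proof -
  let ?E = "(\<lambda>j. entry w j p) ` crossings w"
  have "Max ?E \<in> ?E" using assms finite_crossings by (intro Max_in) auto
  then obtain j where "j \<in> crossings w" "Max ?E = entry w j p" by blast
  moreover have "entry w k p \<le> Max ?E" if "k \<in> crossings w" for k
    using that finite_crossings by (intro Max_ge) auto
  ultimately show ?thesis by auto
qed

lemma slack_prod_at_entry:
  assumes "w \<noteq> 0" and j: "j \<in> crossings w"
  shows "slack_prod (p + (entry w j p - coord w p) *\<^sub>R w) = 0"
proof -
  have "slack j (p + (entry w j p - coord w p) *\<^sub>R w) = 0"
    using assms by (subst slack_entry[OF j]) (simp add: entry_shift)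
  then show ?thesis
    using crossingsD(1)[OF j] finite_I by (auto simp: slack_prod_def prod_zero_iff)
qed

text \<open>
The map \<open>G\<close> moves points along \<open>w\<close>. Where the product \<open>N\<close> of the slacks is near \<open>1\<close>, it pulls them back
almost to the entry of the line into the chamber; where \<open>N = 0\<close>, in particular on the boundary, it is
the identity. The new coordinate is \<open>x + \<theta> (s - x)\<close> with \<open>\<theta> = (N (2 - N))\<^sup>2\<close> and \<open>s\<close> a soft
maximum of the entries.

It stays in the chamber because \<open>s\<close> exceeds all entries: for \<open>\<theta> \<le> 1\<close> the new coordinate is a convex
combination of \<open>x\<close> and \<open>s\<close>, and \<open>\<theta> > 1\<close> happens only away from \<open>N = 1\<close>, where \<open>s \<ge> x\<close> and points are
moved inwards. The free parameter of the soft maximum is \<open>\<tau> = H (N - 1)\<close>; as \<open>H\<close> is huge, \<open>\<tau>\<close> covers all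
relevant values while \<open>N\<close> stays so near \<open>1\<close>, a double point of \<open>\<theta> = 1\<close>, that \<open>\<theta>\<close> is \<open>1\<close> up to a negligible
error.

The last two conclusions are the two ways of finding preimages. A point \<open>q\<close> close to the boundary has
a preimage at which each slack differs from that of \<open>q\<close> by at most a polynomial factor, because
\<open>\<theta>\<close> is divisible by every slack. A point whose distance along \<open>w\<close> from the entry is at least \<open>2 / C\<close>,
with \<open>C\<close> evaluated anywhere on the line where \<open>N \<ge> 1\<close>, is the image of such a far point.
\<close>

lemma pulling_map:
  assumes w: "\<And>i. i \<in> I \<Longrightarrow> 0 \<le> g i \<bullet> w" "w \<noteq> 0" and J: "crossings w \<noteq> {}"
    and C: "real_polynomial_function C" "\<And>p. 1 \<le> C p"
  obtains G :: "'a \<Rightarrow> 'a" and K :: "'a \<Rightarrow> real"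
  where "polynomial_function G" and "G ` chamber \<subseteq> chamber"
    and "real_polynomial_function K" and "\<And>p. 1 \<le> K p"
    and "\<And>q. \<lbrakk>q \<in> chamber; slack_prod q \<le> 1/2\<rbrakk> \<Longrightarrow>
      \<exists>p\<in>chamber. G p = q \<and> (\<forall>j\<in>I. slack j p \<le> slack j q \<and> slack j q \<le> slack j p * K p)"
    and "\<And>q. \<lbrakk>q \<in> chamber;
        \<And>t j. \<lbrakk>q + t *\<^sub>R w \<in> chamber; 1 \<le> slack_prod (q + t *\<^sub>R w); j \<in> crossings w\<rbrakk> \<Longrightarrow>
          entry w j q + 2 / C (q + t *\<^sub>R w) \<le> coord w q\<rbrakk> \<Longrightarrow>
      \<exists>p\<in>chamber. 1 \<le> slack_prod p \<and> G p = q"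
proof -
  let ?N = slack_prod and ?x = "coord w" and ?R = "entry_bound w"
  obtain js where js: "set js = crossings w" using finite_list[OF finite_crossings] by blast
  \<comment> \<open>\<open>B\<close> brings the soft maximum within \<open>1 / C\<close> of the entry. \<open>H\<close> ensures \<open>s \<ge> x\<close> for \<open>\<bar>N - 1\<bar> \<ge> 1/2\<close>, and for the relevant \<open>\<tau>\<close> it makes \<open>1 - \<theta>\<close> times the length of the move at most \<open>1 / C\<close>.\<close>
  define D where "D p = ?R p + 1 + (?x p)\<^sup>2" for p
  define H where "H p = 4 * D p * C p" for p
  define \<tau> where "\<tau> p = H p * (?N p - 1)" for p
  define B where "B p = C p ^ length js" for p
  define s where "s p = soft_coord w js p (B p) (\<tau> p)" for p
  define \<theta> where "\<theta> p = (?N p * (2 - ?N p))\<^sup>2" for p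
  define \<psi> where "\<psi> p = ?x p + \<theta> p * (s p - ?x p)" for p
  define G where "G p = p + (\<psi> p - ?x p) *\<^sub>R w" for p
  define \<kappa> where "\<kappa> j p = 1 + (g j \<bullet> w) * cofactor j p * ?N p * (2 - ?N p)\<^sup>2 * (s p - ?x p)" for j p
  define K where "K p = 2 + (\<Sum>j\<in>I. (\<kappa> j p)\<^sup>2)" for p
  note polys = real_polynomial_function_coord real_polynomial_function_slack_prod
    real_polynomial_function_entry_bound real_polynomial_function_cofactor C(1)
  have poly_\<tau>: "real_polynomial_function \<tau>"
    unfolding \<tau>_def[abs_def] H_def D_def by (intro real_polynomial_function_intros polys)
  have poly_B: "real_polynomial_function B"
    unfolding B_def[abs_def] by (intro real_polynomial_function_intros polys)
  have poly_s: "real_polynomial_function s"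
    unfolding s_def[abs_def] by (intro real_polynomial_function_soft_coord poly_\<tau> poly_B)
  have poly_\<psi>: "real_polynomial_function \<psi>"
    unfolding \<psi>_def[abs_def] \<theta>_def by (intro real_polynomial_function_intros polys poly_s)
  have poly_G: "polynomial_function G"
    unfolding G_def[abs_def]
    by (intro polynomial_function_shift_along real_polynomial_function_intros polys poly_\<psi>)
  have poly_K: "real_polynomial_function K"
    unfolding K_def[abs_def] \<kappa>_def by (intro real_polynomial_function_intros polys poly_s finite_I)
  have K1: "1 \<le> K p" for p by (simp add: K_def sum_nonneg add_increasing2)
  have R1: "1 \<le> ?R p" for p by (rule one_le_entry_bound)
  have D2: "2 \<le> D p" for p using R1[of p] zero_le_power2[of "?x p"] unfolding D_def by linarith
  have xD: "\<bar>?x p\<bar> + ?R p \<le> D p" for p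
    using abs_le_one_plus_square[of "?x p"] by (simp add: D_def)
  have B1: "1 \<le> B p" for p unfolding B_def using C(2) by simp
  have s_gt: "entry w j p < s p" if "j \<in> crossings w" for j p
    unfolding s_def using soft_coord_greater[OF js _ that] B1[of p] by simp
  have H2: "16 * D p \<le> (H p)\<^sup>2" for p
  proof -
    have "D p * 1 \<le> D p * D p" using D2[of p] by (intro mult_left_mono) auto
    moreover have "1 \<le> (C p)\<^sup>2" using C(2)[of p] by simp
    ultimately have "D p * 1 \<le> (D p * D p) * (C p)\<^sup>2"
      using D2[of p] by (intro mult_mono) auto
    then show ?thesis by (simp add: H_def power2_eq_square algebra_simps)
  qed
  have \<tau>_far: "4 * D p \<le> (\<tau> p)\<^sup>2" if "1/2 \<le> \<bar>?N p - 1\<bar>" for p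
  proof -
    have "(1/2)\<^sup>2 \<le> (?N p - 1)\<^sup>2"
      using that abs_le_square_iff[of "1/2" "?N p - 1"] by simp
    then have "(16 * D p) * (1/2)\<^sup>2 \<le> (H p)\<^sup>2 * (?N p - 1)\<^sup>2"
      using H2[of p] D2[of p] by (intro mult_mono) auto
    then show ?thesis by (simp add: \<tau>_def power_mult_distrib power_one_over)
  qed
  have s_far: "?x p \<le> s p" if "1/2 \<le> \<bar>?N p - 1\<bar>" for p
    using \<tau>_far[OF that] soft_coord_ge[of "\<tau> p" w p js "B p"] xD[of p] D2[of p]
    by (simp add: s_def)
  have \<theta>0: "0 \<le> \<theta> p" for p by (simp add: \<theta>_def)
  have \<theta>_near: "\<theta> p \<le> 1 \<and> 1 - \<theta> p \<le> 2 * (?N p - 1)\<^sup>2" if "\<bar>?N p - 1\<bar> \<le> 1/2" for p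
  proof -
    define e where "e = (?N p - 1)\<^sup>2"
    have "e \<le> (1/2)\<^sup>2" unfolding e_def using that abs_le_square_iff[of "?N p - 1" "1/2"] by simp
    then have e: "0 \<le> e" "e \<le> 1" by (auto simp: e_def power2_eq_square)
    have "\<theta> p = (1 - e)\<^sup>2" by (simp add: \<theta>_def e_def power2_eq_square algebra_simps)
    moreover have "(1 - e)\<^sup>2 \<le> 1" using e by (simp add: power_le_one)
    moreover have "1 - (1 - e)\<^sup>2 \<le> 2 * e" by (simp add: power2_eq_square algebra_simps)
    ultimately show ?thesis by (simp add: e_def)
  qed
  have \<psi>_gt: "entry w j p < \<psi> p" if "p \<in> chamber" "j \<in> crossings w" for j p
  proof (cases "1/2 \<le> \<bar>?N p - 1\<bar>")
    case True
    then have "0 \<le> \<theta> p * (s p - ?x p)" using \<theta>0 s_far by simp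
    then show ?thesis using entry_less_coord[OF that] by (simp add: \<psi>_def)
  next
    case False
    then have \<theta>: "\<theta> p \<le> 1" using \<theta>_near[of p] by simp
    have "\<psi> p - entry w j p = (1 - \<theta> p) * (?x p - entry w j p) + \<theta> p * (s p - entry w j p)"
      by (simp add: \<psi>_def algebra_simps)
    moreover have "0 < (1 - \<theta> p) * (?x p - entry w j p) + \<theta> p * (s p - entry w j p)"
    proof (cases "\<theta> p = 0")
      case False
      then have "0 < \<theta> p * (s p - entry w j p)" using \<theta>0[of p] s_gt[OF that(2), of p] by simp
      then show ?thesis
        using \<theta> entry_less_coord[OF that] by (intro add_nonneg_pos mult_nonneg_nonneg) auto
    qed (use entry_less_coord[OF that] in simp)
    ultimately show ?thesis by simp
  qed
  have G_chamber: "G ` chamber \<subseteq> chamber"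
    using chamber_on_line[OF w] \<psi>_gt by (auto simp: G_def)

  \<comment> \<open>The map fixes the entry \<open>a\<close> of the line of \<open>q\<close> and moves \<open>q\<close> inwards, so \<open>q\<close> is attained in between.\<close>
  have near: "\<exists>p\<in>chamber. G p = q \<and> (\<forall>j\<in>I. slack j p \<le> slack j q \<and> slack j q \<le> slack j p * K p)"
    if q: "q \<in> chamber" and Nq: "?N q \<le> 1/2" for q
  proof -
    define l where "l x = q + (x - ?x q) *\<^sub>R w" for x
    have xl: "?x (l x) = x" for x using w(2) by (simp add: l_def)
    obtain j\<^sub>0 where j\<^sub>0: "j\<^sub>0 \<in> crossings w"
      and max: "\<forall>j\<in>crossings w. entry w j q \<le> entry w j\<^sub>0 q"
      using last_entry[OF J, of q] by blast
    define a where "a = entry w j\<^sub>0 q"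
    note j\<^sub>0 = j\<^sub>0 a_def
    have a_max: "entry w j q \<le> a" if "j \<in> crossings w" for j
      using max that by (simp add: a_def)
    have "?N (l a) = 0"
      using slack_prod_at_entry[OF w(2) j\<^sub>0(1)] by (simp add: l_def a_def)
    then have \<psi>a: "\<psi> (l a) = a" by (simp add: \<psi>_def \<theta>_def xl)
    have aq: "a < ?x q" using j\<^sub>0 entry_less_coord[OF q] by simp
    have "?x q \<le> \<psi> q"
      using s_far[of q] Nq \<theta>0[of q] by (simp add: \<psi>_def)
    then have "?x q \<le> \<psi> (l (?x q))" by (simp add: l_def)
    moreover have "continuous_on X (\<lambda>x. \<psi> (l x))" for X
      unfolding l_def by (rule continuous_on_along_line[OF poly_\<psi>])
    ultimately obtain x where x: "a \<le> x" "x \<le> ?x q" "\<psi> (l x) = ?x q"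
      using IVT'[of "\<lambda>x. \<psi> (l x)" a "?x q" "?x q"] \<psi>a aq by auto
    have "x \<noteq> a" using x(3) \<psi>a aq by auto
    then have p: "l x \<in> chamber"
      unfolding l_def using a_max x(1) by (intro chamber_on_line[OF w] q) force+
    have Gp: "G (l x) = q" by (simp add: G_def xl x(3)) (simp add: l_def flip: scaleR_add_left)
    have "slack j (l x) \<le> slack j q \<and> slack j q \<le> slack j (l x) * K (l x)" if j: "j \<in> I" for j
    proof
      show "slack j (l x) \<le> slack j q"
        using w(1)[OF j] x(2) by (simp add: l_def slack_shift mult_nonpos_nonneg)
      have "slack j q = slack j (l x) + (\<psi> (l x) - x) * (g j \<bullet> w)"
        by (metis G_def Gp slack_shift xl)
      also have "\<dots> = slack j (l x) * \<kappa> j (l x)"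
        using slack_prod_cofactor[OF j, of "l x"]
        by (simp add: \<psi>_def \<theta>_def xl \<kappa>_def power2_eq_square algebra_simps)
      also have "\<dots> \<le> slack j (l x) * K (l x)"
      proof (intro mult_left_mono)
        have "(\<kappa> j (l x))\<^sup>2 \<le> (\<Sum>j\<in>I. (\<kappa> j (l x))\<^sup>2)"
          using j finite_I by (intro member_le_sum) auto
        then show "\<kappa> j (l x) \<le> K (l x)"
          using abs_le_one_plus_square[of "\<kappa> j (l x)"] by (simp add: K_def)
        show "0 \<le> slack j (l x)" using p j by (simp add: chamber_def less_imp_le)
      qed
      finally show "slack j q \<le> slack j (l x) * K (l x)" .
    qed
    then show ?thesis using p Gp by blast
  qed

  \<comment> \<open>On the line of \<open>q\<close>, the soft maximum nearly equals the entry \<open>a\<close> at some \<open>y\<close> with \<open>1 \<le> N \<le> 3/2\<close>; from \<open>y\<close> to infinity the image covers \<open>q\<close>.\<close>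
  have far: "\<exists>p\<in>chamber. 1 \<le> ?N p \<and> G p = q"
    if q: "q \<in> chamber" and gap: "\<And>t j. \<lbrakk>q + t *\<^sub>R w \<in> chamber; 1 \<le> ?N (q + t *\<^sub>R w); j \<in> crossings w\<rbrakk> \<Longrightarrow>
          entry w j q + 2 / C (q + t *\<^sub>R w) \<le> ?x q" for q
  proof -
    define l where "l x = q + (x - ?x q) *\<^sub>R w" for x
    have xl: "?x (l x) = x" for x using w(2) by (simp add: l_def)
    have cont: "continuous_on X (\<lambda>x. f (l x))" if "real_polynomial_function f" for X f
      unfolding l_def by (rule continuous_on_along_line[OF that])
    obtain j\<^sub>0 where j\<^sub>0: "j\<^sub>0 \<in> crossings w"
      and max: "\<forall>j\<in>crossings w. entry w j q \<le> entry w j\<^sub>0 q"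
      using last_entry[OF J, of q] by blast
    define a where "a = entry w j\<^sub>0 q"
    note j\<^sub>0 = j\<^sub>0 a_def
    have a_max: "entry w j q \<le> a" if "j \<in> crossings w" for j
      using max that by (simp add: a_def)
    have Na: "?N (l a) = 0"
      using slack_prod_at_entry[OF w(2) j\<^sub>0(1)] by (simp add: l_def a_def)
    have aq: "a < ?x q" using j\<^sub>0 entry_less_coord[OF q] by simp
    have lc: "l x \<in> chamber" if "a < x" for x
      unfolding l_def using a_max that by (intro chamber_on_line[OF w] q) force+
    have N_mono: "?N (l x) \<le> ?N (l x')" if "a < x" "x \<le> x'" for x x'
    proof -
      have "l x' = l x + (x' - x) *\<^sub>R w" by (simp add: l_def flip: scaleR_add_left)
      then show ?thesis using slack_prod_mono[OF lc[OF that(1)] w(1), of "x' - x"] that by simp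
    qed
    define X where "X = ?x q + 2 / ((g j\<^sub>0 \<bullet> w) * cofactor j\<^sub>0 q)"
    have pos: "0 < (g j\<^sub>0 \<bullet> w) * cofactor j\<^sub>0 q"
      using cofactor_pos[OF q, of j\<^sub>0] crossingsD(2)[OF j\<^sub>0(1)] by simp
    have "0 < 2 / ((g j\<^sub>0 \<bullet> w) * cofactor j\<^sub>0 q)" using pos by (intro divide_pos_pos) auto
    then have aX: "a < X" using aq unfolding X_def by linarith
    have "2 \<le> ?N (l X)"
    proof -
      let ?t = "2 / ((g j\<^sub>0 \<bullet> w) * cofactor j\<^sub>0 q)"
      have I: "j\<^sub>0 \<in> I" using j\<^sub>0 crossings_subset by blast
      have t: "0 \<le> ?t" using pos by simp
      have "2 = (?t * (g j\<^sub>0 \<bullet> w)) * cofactor j\<^sub>0 q" using pos by auto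
      also have "\<dots> \<le> slack j\<^sub>0 (q + ?t *\<^sub>R w) * cofactor j\<^sub>0 (q + ?t *\<^sub>R w)"
      proof (intro mult_mono)
        show "?t * (g j\<^sub>0 \<bullet> w) \<le> slack j\<^sub>0 (q + ?t *\<^sub>R w)"
          using q I by (simp add: slack_shift chamber_def less_imp_le)
        show "cofactor j\<^sub>0 q \<le> cofactor j\<^sub>0 (q + ?t *\<^sub>R w)"
          by (rule cofactor_mono[OF q w(1) t])
        have "0 \<le> ?t * (g j\<^sub>0 \<bullet> w)" using t w(1)[OF I] by (rule mult_nonneg_nonneg)
        then show "0 \<le> slack j\<^sub>0 (q + ?t *\<^sub>R w)"
          using q I by (simp add: slack_shift chamber_def less_imp_le)
        show "0 \<le> cofactor j\<^sub>0 q" using cofactor_pos[OF q, of j\<^sub>0] by simp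
      qed
      also have "\<dots> = ?N (l X)"
        using slack_prod_cofactor[OF I, of "l X"] by (simp add: l_def X_def)
      finally show ?thesis .
    qed
    then obtain u where u: "a \<le> u" "u \<le> X" "?N (l u) = 1"
      using IVT'[of "\<lambda>x. ?N (l x)" a 1 X] cont[OF real_polynomial_function_slack_prod] Na aX by auto
    then have au: "a < u" using Na by (cases "u = a") auto
    obtain v where v: "u \<le> v" "v \<le> X" "?N (l v) = 3/2"
      using IVT'[of "\<lambda>x. ?N (l x)" u "3/2" X] cont[OF real_polynomial_function_slack_prod] u \<open>2 \<le> ?N (l X)\<close>
      by auto
    have R_l: "?R (l x) = ?R q" for x using w(2) by (simp add: l_def entry_bound_shift)
    obtain y where y: "y \<in> {u..v}"
      and y_eq: "(\<Prod>j\<leftarrow>js. soft_coord w js q (B (l y)) (\<tau> (l y)) - entry w j q) = 1 / B (l y)"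
    proof (rule soft_coord_attains[of js w u v "\<lambda>x. \<tau> (l x)" "\<lambda>x. B (l x)" q])
      show "2 * ?R q + 1 \<le> (\<tau> (l v))\<^sup>2"
        using \<tau>_far[of "l v"] xD[of "l v"] D2[of "l v"] v(3) by (simp add: R_l)
      show "\<tau> (l u) = 0" by (simp add: \<tau>_def u(3))
    qed (use js J v(1) B1 cont poly_\<tau> poly_B in auto)
    have ay: "a < y" using y au by simp
    have s_y: "soft_coord w js q (B (l y)) (\<tau> (l y)) = s (l y)"
      unfolding s_def using w(2) js by (simp add: l_def soft_coord_shift)
    have N_y: "1 \<le> ?N (l y)" "?N (l y) \<le> 3/2"
      using N_mono[OF au, of y] N_mono[OF ay, of v] u v y by auto
    have "\<exists>j\<in>set js. s (l y) - entry w j q \<le> 1 / C (l y)"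
    proof (rule exists_small_factor)
      show "(\<Prod>j\<leftarrow>js. s (l y) - entry w j q) \<le> (1 / C (l y)) ^ length js"
        using y_eq unfolding s_y by (simp add: B_def power_one_over)
    qed (use js J C(2)[of "l y"] in auto)
    then have s_le: "s (l y) \<le> a + 1 / C (l y)"
      using a_max js by force
    have C1: "0 < 1 / C (l y)" "1 / C (l y) \<le> 1" using C(2)[of "l y"] by auto
    have a_R: "\<bar>a\<bar> \<le> ?R q" using j\<^sub>0 abs_entry_le by simp
    have s_gt_a: "a < s (l y)"
      using s_gt[OF j\<^sub>0(1), of "l y"] w(2) j\<^sub>0 by (simp add: l_def entry_shift)
    have \<psi>_y: "\<psi> (l y) \<le> s (l y) + 1 / C (l y)"
    proof -
      define d where "d = D (l y)"
      define c where "c = C (l y)"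
      define e where "e = (?N (l y) - 1)\<^sup>2"
      have c: "1 \<le> c" using C(2) by (simp add: c_def)
      have d: "2 \<le> d" using D2 by (simp add: d_def)
      have "\<bar>?N (l y) - 1\<bar> \<le> 1/2" using N_y by auto
      then have \<theta>: "0 \<le> 1 - \<theta> (l y)" "1 - \<theta> (l y) \<le> 2 * e"
        using \<theta>_near[of "l y"] by (auto simp: e_def)
      have "y - s (l y) \<le> 2 * d"
        using s_gt_a a_R xD[of "l y"] d by (simp add: d_def xl R_l)
      then have "(1 - \<theta> (l y)) * (y - s (l y)) \<le> (1 - \<theta> (l y)) * (2 * d)"
        using \<theta>(1) by (rule mult_left_mono)
      also have "\<dots> \<le> (2 * e) * (2 * d)"
        using \<theta>(2) d by (intro mult_right_mono) auto
      also have "\<dots> \<le> 1 / c"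
      proof -
        have "(\<tau> (l y))\<^sup>2 \<le> s (l y) + ?R (l y)"
          using soft_coord_ge[of "\<tau> (l y)" w "l y" js "B (l y)"] by (simp add: s_def)
        also have "\<dots> \<le> 2 * d"
        proof -
          have "s (l y) \<le> ?R q + 1" using order_trans[OF s_le add_mono[OF _ C1(2)]] a_R by simp
          moreover have "?R q + 1 \<le> d" by (simp add: d_def D_def R_l)
          ultimately show ?thesis by (simp add: R_l)
        qed
        finally have "(4 * d * c)\<^sup>2 * e \<le> 2 * d"
          by (simp add: \<tau>_def H_def d_def c_def e_def power_mult_distrib)
        then have "(2 * d) * (8 * d * c\<^sup>2 * e) \<le> (2 * d) * 1"
          by (simp add: power2_eq_square algebra_simps)
        then have le: "8 * d * c\<^sup>2 * e \<le> 1" using d by (subst (asm) mult_le_cancel_left_pos) auto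
        have "4 * d * e * c * 1 \<le> 4 * d * e * c * (2 * c)"
          using c d by (intro mult_left_mono) (auto simp: e_def)
        then have "4 * d * e * c \<le> 1" using le by (simp add: power2_eq_square algebra_simps)
        then show ?thesis using c by (simp add: field_simps)
      qed
      finally show ?thesis by (simp add: \<psi>_def xl c_def algebra_simps)
    qed
    have "a + 2 / C (l y) \<le> ?x q"
      using gap[of "y - ?x q" j\<^sub>0] lc[OF ay] N_y(1) j\<^sub>0 by (simp add: l_def)
    then have low: "\<psi> (l y) \<le> ?x q" using \<psi>_y s_le by simp
    define Y where "Y = max v (?x q)"
    have vY: "v \<le> Y" "?x q \<le> Y" by (auto simp: Y_def)
    have "3/2 \<le> ?N (l Y)" using N_mono[of v Y] v au vY by auto
    then have "0 \<le> \<theta> (l Y) * (s (l Y) - ?x (l Y))"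
      using s_far[of "l Y"] \<theta>0 by (intro mult_nonneg_nonneg) auto
    then have "?x q \<le> \<psi> (l Y)" using vY by (simp add: \<psi>_def xl)
    then obtain x where x: "y \<le> x" "\<psi> (l x) = ?x q"
      using IVT'[of "\<lambda>x. \<psi> (l x)" y "?x q" Y] low y vY cont[OF poly_\<psi>] by auto
    have "G (l x) = q" by (simp add: G_def xl x(2)) (simp add: l_def flip: scaleR_add_left)
    moreover have "1 \<le> ?N (l x)" using N_mono[OF ay x(1)] N_y(1) by simp
    moreover have "l x \<in> chamber" using lc ay x(1) by simp
    ultimately show ?thesis by blast
  qed
  show ?thesis
    using that[OF poly_G G_chamber poly_K K1 near far] .
qed

text \<open>
The direction \<open>w\<close> of an unbounded facet gives a pulling map that covers all points at which the slack
of this facet is the smallest one up to the factor \<open>\<kappa>\<close>. On a line in direction \<open>w\<close> the slack of the facet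
is constant; where the product of all slacks is at least \<open>1\<close>, it is at least the inverse of the product
of the others, which is a polynomial. So the distance of \<open>q\<close> from the entry, which is controlled by
the other slacks and thus by the slack of the facet, has a lower bound \<open>2 / C\<close> with a polynomial \<open>C\<close>.
Points with product at least \<open>1/2\<close> are bounded away from the entry for the same reason.
\<close>

lemma facet_approached_from_infinity:
  assumes w: "\<And>i. i \<in> I \<Longrightarrow> 0 \<le> g i \<bullet> w" "w \<noteq> 0" and J: "crossings w \<noteq> {}"
    and i: "i \<in> I" "g i \<bullet> w = 0" and \<kappa>: "real_polynomial_function \<kappa>"
  obtains G :: "'a \<Rightarrow> 'a" and K :: "'a \<Rightarrow> real"
  where "polynomial_function G" and "G ` chamber \<subseteq> chamber"
    and "real_polynomial_function K" and "\<And>p. 1 \<le> K p"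
    and "\<And>q. \<lbrakk>q \<in> chamber; slack_prod q \<le> 1/2\<rbrakk> \<Longrightarrow>
      \<exists>p\<in>chamber. G p = q \<and> (\<forall>j\<in>I. slack j p \<le> slack j q \<and> slack j q \<le> slack j p * K p)"
    and "\<And>q. \<lbrakk>q \<in> chamber; 1/2 \<le> slack_prod q \<or> (\<forall>j\<in>I. slack i q \<le> slack j q * \<kappa> q)\<rbrakk> \<Longrightarrow>
      \<exists>p\<in>chamber. 1 \<le> slack_prod p \<and> G p = q"
proof -
  define T where "T p = 1 + (coord w p)\<^sup>2 + entry_bound w p" for p
  have T0: "0 \<le> T p" for p using one_le_entry_bound[of w p] by (simp add: T_def)
  have poly_T: "real_polynomial_function T"
    unfolding T_def[abs_def]
    by (intro real_polynomial_function_intros real_polynomial_function_coord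
        real_polynomial_function_entry_bound)
  obtain h where h: "real_polynomial_function h"
    and h_le: "\<And>p t. \<bar>t\<bar> \<le> T p \<Longrightarrow> \<bar>\<kappa> (p + t *\<^sub>R w)\<bar> \<le> h p"
    using real_polynomial_function_majorant_on_segments[OF \<kappa> poly_T T0, of w] by blast
  have h0: "0 \<le> h p" for p using h_le[of 0 p] T0[of p] by simp
  \<comment> \<open>Where \<open>N \<ge> 1\<close>, all slacks are at least \<open>1 / Q\<close>; \<open>h\<close> bounds \<open>\<kappa>\<close> between that point and the entry of the line; \<open>\<Lambda>\<close> converts slacks into coordinates.\<close>
  define \<Lambda> where "\<Lambda> = 1 + (\<Sum>j\<in>I. g j \<bullet> w)"
  define Q where "Q p = 1 + (\<Sum>j\<in>I. (cofactor j p)\<^sup>2)" for p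
  define Z where "Z p = Q p * (1 + h p)" for p
  define C where "C p = 4 * \<Lambda> * Z p" for p
  have \<Lambda>: "1 \<le> \<Lambda>" unfolding \<Lambda>_def using w(1) by (simp add: sum_nonneg)
  have Q1: "1 \<le> Q p" for p by (simp add: Q_def sum_nonneg)
  have Z1: "1 \<le> Z p" "Q p \<le> Z p" for p
    using mult_mono[of 1 "Q p" 1 "1 + h p"] mult_left_mono[of 1 "1 + h p" "Q p"] Q1[of p] h0[of p]
    by (auto simp: Z_def)
  have C1: "1 \<le> C p" for p
    unfolding C_def using mult_mono[of 1 "4 * \<Lambda>" 1 "Z p"] \<Lambda> Z1(1)[of p] by simp
  have poly_C: "real_polynomial_function C"
    unfolding C_def[abs_def] Z_def Q_def
    by (intro real_polynomial_function_intros real_polynomial_function_cofactor finite_I h)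
  show ?thesis
  proof (rule pulling_map[OF w J poly_C C1])
    fix G :: "'a \<Rightarrow> 'a" and K :: "'a \<Rightarrow> real"
    assume G: "polynomial_function G" "G ` chamber \<subseteq> chamber"
      "real_polynomial_function K" "\<And>p. 1 \<le> K p"
      "\<And>q. \<lbrakk>q \<in> chamber; slack_prod q \<le> 1/2\<rbrakk> \<Longrightarrow>
      \<exists>p\<in>chamber. G p = q \<and> (\<forall>j\<in>I. slack j p \<le> slack j q \<and> slack j q \<le> slack j p * K p)"
      "\<And>q. \<lbrakk>q \<in> chamber;
        \<And>t j. \<lbrakk>q + t *\<^sub>R w \<in> chamber; 1 \<le> slack_prod (q + t *\<^sub>R w); j \<in> crossings w\<rbrakk> \<Longrightarrow>
          entry w j q + 2 / C (q + t *\<^sub>R w) \<le> coord w q\<rbrakk> \<Longrightarrow>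
      \<exists>p\<in>chamber. 1 \<le> slack_prod p \<and> G p = q"
    have "\<exists>p\<in>chamber. 1 \<le> slack_prod p \<and> G p = q"
      if q: "q \<in> chamber" and cases: "1/2 \<le> slack_prod q \<or> (\<forall>j\<in>I. slack i q \<le> slack j q * \<kappa> q)" for q
    proof (rule G(6)[OF q])
      fix t j
      define y where "y = q + t *\<^sub>R w"
      assume "q + t *\<^sub>R w \<in> chamber" "1 \<le> slack_prod (q + t *\<^sub>R w)" and j: "j \<in> crossings w"
      then have y: "y \<in> chamber" "1 \<le> slack_prod y" by (auto simp: y_def)
      have qy: "q = y + (- t) *\<^sub>R w" by (simp add: y_def)
      have jI: "j \<in> I" and gj: "0 < g j \<bullet> w" using crossingsD[OF j] by auto
      have cof: "cofactor k y \<le> Q y" if "k \<in> I" for k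
      proof -
        have "(cofactor k y)\<^sup>2 \<le> (\<Sum>j\<in>I. (cofactor j y)\<^sup>2)"
          using that finite_I by (intro member_le_sum) auto
        then show ?thesis using abs_le_one_plus_square[of "cofactor k y"] by (simp add: Q_def)
      qed
      have slack_y: "1 \<le> slack k y * Q y" if "k \<in> I" for k
      proof -
        have "1 \<le> slack k y * cofactor k y" using y(2) slack_prod_cofactor[OF that] by simp
        also have "\<dots> \<le> slack k y * Q y"
          using cof[OF that] y(1) that by (intro mult_left_mono) (auto simp: chamber_def less_imp_le)
        finally show ?thesis .
      qed
      have sq: "0 < slack j q" using q jI by (simp add: chamber_def)
      have up: "1 \<le> 2 * slack j q * Z y" if "1 \<le> 2 * slack j q * Q y"
        using order_trans[OF that mult_left_mono[OF Z1(2)[of y], of "2 * slack j q"]] sq by simp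
      \<comment> \<open>The slack of \<open>j\<close> at \<open>q\<close> is bounded below in terms of \<open>y\<close>: either \<open>q\<close> lies further inside than \<open>y\<close>, or one of the two assumptions on \<open>q\<close> applies.\<close>
      have "1 \<le> 2 * slack j q * Z y"
      proof (cases "t \<le> 0")
        case True
        then have "slack j y \<le> slack j q"
          using gj by (simp add: y_def slack_shift mult_nonpos_nonneg)
        then have "slack j y * Q y \<le> slack j q * Q y"
          using Q1[of y] by (intro mult_right_mono) auto
        moreover have "1 \<le> slack j y * Q y" by (rule slack_y[OF jI])
        ultimately show ?thesis by (intro up) (simp add: mult.assoc)
      next
        case False
        show ?thesis
          using cases
        proof
          assume "1/2 \<le> slack_prod q"
          then have "1/2 \<le> slack j q * cofactor j q" using slack_prod_cofactor[OF jI] by simp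
          also have "\<dots> \<le> slack j q * Q y"
            using cofactor_mono[OF q w(1), of t j] cof[OF jI] False sq
            by (intro mult_left_mono) (auto simp: y_def)
          finally show ?thesis by (intro up) simp
        next
          assume le: "\<forall>j\<in>I. slack i q \<le> slack j q * \<kappa> q"
          have "t < coord w y - entry w j y"
            using entry_less_coord[OF q j] w(2) j by (simp add: y_def entry_shift)
          also have "\<dots> \<le> T y"
            using abs_entry_le[OF j, of y] abs_le_one_plus_square[of "coord w y"] by (simp add: T_def)
          finally have "\<bar>- t\<bar> \<le> T y" using False by simp
          then have "\<kappa> q \<le> 1 + h y" using h_le[of "- t" y] qy by simp
          then have "slack j q * \<kappa> q \<le> slack j q * (1 + h y)" using sq by (intro mult_left_mono) auto
          moreover have "slack i q = slack i y" using i(2) by (simp add: y_def slack_shift)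
          ultimately have "slack i y \<le> slack j q * (1 + h y)" using le jI by force
          then have "slack i y * Q y \<le> slack j q * (1 + h y) * Q y"
            using Q1[of y] by (intro mult_right_mono) auto
          moreover have "1 \<le> slack i y * Q y" by (rule slack_y[OF i(1)])
          ultimately have "1 \<le> slack j q * Z y" by (simp add: Z_def mult_ac)
          then show ?thesis by simp
        qed
      qed
      moreover have "g j \<bullet> w \<le> \<Lambda>"
        unfolding \<Lambda>_def using member_le_sum[of j I "\<lambda>j. g j \<bullet> w"] jI w(1) finite_I by auto
      then have "(g j \<bullet> w) * 1 \<le> \<Lambda> * (2 * slack j q * Z y)"
        using calculation \<Lambda> by (intro mult_mono) auto
      then have "2 / C y \<le> slack j q / (g j \<bullet> w)"
        using \<Lambda> Z1(1)[of y] gj by (simp add: C_def field_simps)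
      moreover have "slack j q / (g j \<bullet> w) = coord w q - entry w j q"
        by (simp add: entry_def)
      ultimately show "entry w j q + 2 / C (q + t *\<^sub>R w) \<le> coord w q" by (simp add: y_def)
    qed
    then show ?thesis using that[OF G(1-5)] by blast
  qed
qed

section \<open>Composing the maps of all facets\<close>

text \<open>
The pulling maps of the facets are composed. The map applied last is fixed first: a point near a facet
treated by an earlier map is traced back through it by the first kind of preimage, which distorts the
slacks by a polynomial factor \<open>K\<close> only, and this factor is absorbed in the \<open>\<kappa>\<close> for the
remaining facets. When all facets are treated, \<open>\<kappa> = 1\<close> suffices, since at every point some slack is
minimal. Each composition covers the core, where the product of the slacks is at least \<open>1/2\<close>, from
the core, and the core is covered by \<open>chamber_nearly_covered\<close>. Absence of lines ensures that
the directions \<open>w i\<close> cross some bounding hyperplane, so that the product of slacks grows along them.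
\<close>

lemma chamber_without_line_is_polynomial_image:
  assumes v: "\<And>i. i \<in> I \<Longrightarrow> 0 < g i \<bullet> v" and "I \<noteq> {}"
    and w: "\<And>i. i \<in> I \<Longrightarrow> w i \<noteq> 0" "\<And>i. i \<in> I \<Longrightarrow> g i \<bullet> w i = 0"
      "\<And>i j. \<lbrakk>i \<in> I; j \<in> I\<rbrakk> \<Longrightarrow> 0 \<le> g j \<bullet> w i"
    and no_line: "\<And>u. u \<noteq> 0 \<Longrightarrow> \<exists>i\<in>I. g i \<bullet> u \<noteq> 0"
  shows "\<exists>f :: 'a \<Rightarrow> 'a. polynomial_function f \<and> range f = chamber"
proof -
  have J: "crossings (w i) \<noteq> {}" if i: "i \<in> I" for i
  proof -
    obtain j where "j \<in> I" "g j \<bullet> w i \<noteq> 0" using no_line[OF w(1)[OF i]] by blast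
    then have "j \<in> crossings (w i)" using w(3)[OF i] by (force simp: crossings_def)
    then show ?thesis by blast
  qed
  define core where "core = {p \<in> chamber. 1/2 \<le> slack_prod p}"
  have main: "\<exists>G. polynomial_function G \<and> G ` chamber \<subseteq> chamber \<and> core \<subseteq> G ` core \<and>
      (\<forall>q\<in>chamber. (\<exists>i\<in>S. \<forall>j\<in>I. slack i q \<le> slack j q * \<kappa> q) \<longrightarrow> q \<in> G ` core)"
    if "finite S" "S \<subseteq> I" "real_polynomial_function \<kappa>" "\<And>p. 0 \<le> \<kappa> p" for S \<kappa>
    using that
  proof (induction S arbitrary: \<kappa> rule: finite_induct)
    case empty
    show ?case by (intro exI[of _ "\<lambda>p. p"]) auto
  next
    case (insert i S)
    then have i: "i \<in> I" by simp
    obtain G K where G: "polynomial_function G" "G ` chamber \<subseteq> chamber"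
      "real_polynomial_function K" "\<And>p. 1 \<le> K p"
      and near: "\<And>q. \<lbrakk>q \<in> chamber; slack_prod q \<le> 1/2\<rbrakk> \<Longrightarrow>
        \<exists>p\<in>chamber. G p = q \<and> (\<forall>j\<in>I. slack j p \<le> slack j q \<and> slack j q \<le> slack j p * K p)"
      and far: "\<And>q. \<lbrakk>q \<in> chamber; 1/2 \<le> slack_prod q \<or> (\<forall>j\<in>I. slack i q \<le> slack j q * \<kappa> q)\<rbrakk> \<Longrightarrow>
        \<exists>p\<in>chamber. 1 \<le> slack_prod p \<and> G p = q"
      by (rule facet_approached_from_infinity[OF w(3)[OF i] w(1)[OF i] J[OF i] i w(2)[OF i] insert.prems(2)])
        (assumption, (rule that; assumption))
    define \<kappa>' where "\<kappa>' p = K p * \<kappa> (G p)" for p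
    have "real_polynomial_function \<kappa>'"
      using real_polynomial_function_compose[OF G(1) insert.prems(2)] G(3)
      unfolding \<kappa>'_def[abs_def] o_def by (intro real_polynomial_function_intros)
    moreover have "0 \<le> \<kappa>' p" for p
      unfolding \<kappa>'_def using G(4)[of p] insert.prems(3)[of "G p"] by (intro mult_nonneg_nonneg) auto
    ultimately obtain G' where G': "polynomial_function G'" "G' ` chamber \<subseteq> chamber" "core \<subseteq> G' ` core"
      "\<And>q. \<lbrakk>q \<in> chamber; \<exists>i\<in>S. \<forall>j\<in>I. slack i q \<le> slack j q * \<kappa>' q\<rbrakk> \<Longrightarrow> q \<in> G' ` core"
      using insert.IH[of \<kappa>'] insert.prems(1) by auto
    have far': "q \<in> (G \<circ> G') ` core"
      if q: "q \<in> chamber" "1/2 \<le> slack_prod q \<or> (\<forall>j\<in>I. slack i q \<le> slack j q * \<kappa> q)" for q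
    proof -
      obtain p where p: "p \<in> chamber" "1 \<le> slack_prod p" "G p = q" using far[OF q] by blast
      then have "p \<in> core" by (simp add: core_def)
      then show ?thesis using G'(3) p(3) by force
    qed
    have near': "q \<in> (G \<circ> G') ` core"
      if q: "q \<in> chamber" "slack_prod q \<le> 1/2" and k: "k \<in> S" "\<forall>j\<in>I. slack k q \<le> slack j q * \<kappa> q" for q k
    proof -
      obtain p where p: "p \<in> chamber" "G p = q"
        and p_slack: "\<And>j. j \<in> I \<Longrightarrow> slack j p \<le> slack j q \<and> slack j q \<le> slack j p * K p"
        using near[OF q] by blast
      have "slack k p \<le> slack j p * \<kappa>' p" if j: "j \<in> I" for j
      proof -
        have "slack k p \<le> slack k q" using p_slack k(1) insert.prems(1) by blast
        also have "\<dots> \<le> slack j q * \<kappa> q" using k(2) j by blast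
        also have "\<dots> \<le> (slack j p * K p) * \<kappa> q"
          using p_slack[OF j] insert.prems(3)[of q] by (intro mult_right_mono) auto
        also have "\<dots> = slack j p * \<kappa>' p" by (simp add: \<kappa>'_def p(2))
        finally show ?thesis .
      qed
      then have "p \<in> G' ` core" using G'(4)[OF p(1)] k(1) by blast
      then show ?thesis using p(2) by force
    qed
    have "q \<in> (G \<circ> G') ` core"
      if "q \<in> chamber" "\<exists>i\<in>insert i S. \<forall>j\<in>I. slack i q \<le> slack j q * \<kappa> q" for q
      using that far'[of q] near'[of q] by (cases "1/2 \<le> slack_prod q") auto
    moreover have "core \<subseteq> (G \<circ> G') ` core" using far' by (auto simp: core_def)
    moreover have "(G \<circ> G') ` chamber \<subseteq> chamber"
      using G(2) G'(2) by (auto simp: image_subset_iff)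
    ultimately show ?case
      using polynomial_function_compose[OF G'(1) G(1)] by (intro exI[of _ "G \<circ> G'"]) blast
  qed
  obtain G where G: "polynomial_function G" "G ` chamber \<subseteq> chamber"
    and onto: "\<forall>q\<in>chamber. (\<exists>i\<in>I. \<forall>j\<in>I. slack i q \<le> slack j q * 1) \<longrightarrow> q \<in> G ` core"
    using main[OF finite_I subset_refl real_polynomial_function.intros(2)[of 1] zero_le_one]
    by (elim exE conjE)
  obtain f :: "'a \<Rightarrow> 'a" where f: "polynomial_function f" "range f \<subseteq> chamber"
    "\<And>q. \<lbrakk>q \<in> chamber; 1 \<le> 2 * slack_prod q\<rbrakk> \<Longrightarrow> q \<in> range f"
    using chamber_nearly_covered[OF v \<open>I \<noteq> {}\<close>, of "\<lambda>_. 2"] by auto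
  have "core \<subseteq> range f" using f(3) by (auto simp: core_def)
  have covered: "q \<in> G ` core" if "q \<in> chamber" for q
  proof (rule onto[simplified, rule_format, OF that])
    obtain i where "is_arg_min (\<lambda>i. slack i q) (\<lambda>i. i \<in> I) i"
      using ex_is_arg_min_if_finite[OF finite_I \<open>I \<noteq> {}\<close>] by blast
    then show "\<exists>i\<in>I. \<forall>j\<in>I. slack i q \<le> slack j q"
      by (intro bexI[of _ i]) (auto simp: is_arg_min_linorder)
  qed
  have "range (G \<circ> f) = chamber"
  proof (intro equalityI subsetI)
    fix q assume "q \<in> range (G \<circ> f)"
    then show "q \<in> chamber" using G(2) f(2) by auto
  next
    fix q assume "q \<in> chamber"
    then obtain p where "p \<in> core" "q = G p" using covered by blast
    then show "q \<in> range (G \<circ> f)" using \<open>core \<subseteq> range f\<close> by auto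
  qed
  with polynomial_function_compose[OF f(1) G(1)] show ?thesis
    by (intro exI[of _ "G \<circ> f"] conjI)
qed

theorem chamber_is_polynomial_image:
  assumes v: "\<And>i. i \<in> I \<Longrightarrow> 0 < g i \<bullet> v"
    and w: "\<And>i. i \<in> I \<Longrightarrow> \<exists>w. w \<noteq> 0 \<and> g i \<bullet> w = 0 \<and> (\<forall>j\<in>I. 0 \<le> g j \<bullet> w)"
  shows "\<exists>f :: 'a \<Rightarrow> 'a. polynomial_function f \<and> range f = chamber"
proof (cases "I = {}")
  case True
  then have "range (\<lambda>p::'a. p) = chamber" unfolding chamber_def by simp
  then show ?thesis using polynomial_function_id by blast
next
  case I: False
  show ?thesis
  proof (cases "\<exists>u. u \<noteq> 0 \<and> (\<forall>i\<in>I. g i \<bullet> u = 0)")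
    case True
    then show ?thesis using chamber_with_line_is_polynomial_image[OF v I] by blast
  next
    case False
    from w obtain w' where "\<And>i. i \<in> I \<Longrightarrow> w' i \<noteq> 0 \<and> g i \<bullet> w' i = 0 \<and> (\<forall>j\<in>I. 0 \<le> g j \<bullet> w' i)"
      by metis
    then show ?thesis
      using False by (intro chamber_without_line_is_polynomial_image[OF v I, of w']) auto
  qed
qed

end

section \<open>Polyhedra\<close>

text \<open>
The direction is a limit of normalised points of \<open>F\<close> that tend to infinity, where the constants
\<open>b j\<close> become negligible.
\<close>

lemma unbounded_polyhedron_direction:
  fixes g :: "'i \<Rightarrow> 'a::euclidean_space"
  assumes "\<not> bounded F" and "\<And>x j. \<lbrakk>x \<in> F; j \<in> I\<rbrakk> \<Longrightarrow> 0 \<le> g j \<bullet> x + b j"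
  obtains w where "w \<noteq> 0" and "\<And>j. j \<in> I \<Longrightarrow> 0 \<le> g j \<bullet> w"
proof -
  have "\<exists>x\<in>F. real n < norm x" for n
    using assms(1) by (metis bounded_iff not_le)
  then obtain x where x: "\<And>n. x n \<in> F" "\<And>n. real n < norm (x n)" by metis
  have pos: "0 < norm (x n)" for n using x(2)[of n] by (meson le_less_trans of_nat_0_le_iff)
  define y where "y n = x n /\<^sub>R norm (x n)" for n
  have "y n \<in> sphere 0 1" for n using pos[of n] by (simp add: y_def)
  then obtain w r where w: "w \<in> sphere 0 1" "strict_mono r" "(y \<circ> r) \<longlonglongrightarrow> w"
    using compact_sphere[of "0::'a" 1] unfolding compact_def by metis
  have inv0: "(\<lambda>n. inverse (norm (x (r n)))) \<longlonglongrightarrow> 0"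
  proof (rule tendsto_inverse_0_at_top)
    have "filterlim (\<lambda>n. norm (x n)) at_top sequentially"
      by (rule filterlim_at_top_mono[OF filterlim_real_sequentially])
        (use x(2) in \<open>auto simp: less_imp_le\<close>)
    then show "filterlim (\<lambda>n. norm (x (r n))) at_top sequentially"
      using filterlim_compose filterlim_subseq[OF w(2)] by blast
  qed
  have "0 \<le> g j \<bullet> w" if "j \<in> I" for j
  proof (rule LIMSEQ_le_const)
    have "(\<lambda>n. g j \<bullet> (y \<circ> r) n + b j * inverse (norm (x (r n)))) \<longlonglongrightarrow> g j \<bullet> w + b j * 0"
      by (intro tendsto_intros w(3) inv0)
    then show "(\<lambda>n. g j \<bullet> (y \<circ> r) n + b j * inverse (norm (x (r n)))) \<longlonglongrightarrow> g j \<bullet> w"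
      by simp
    have "g j \<bullet> (y \<circ> r) n + b j * inverse (norm (x (r n))) = (g j \<bullet> x (r n) + b j) / norm (x (r n))" for n
      by (simp add: y_def add_divide_distrib divide_inverse distrib_left mult.commute)
    then show "\<exists>N. \<forall>n\<ge>N. 0 \<le> g j \<bullet> (y \<circ> r) n + b j * inverse (norm (x (r n)))"
      using assms(2)[OF x(1) that] by simp
  qed
  moreover have "w \<noteq> 0" using w(1) by auto
  ultimately show ?thesis using that by blast
qed

lemma recession_cone_inner_nonpos:
  assumes "v \<in> recession_cone K" and "p \<in> K" and "\<And>x. x \<in> K \<Longrightarrow> a \<bullet> x \<le> c"
  shows "a \<bullet> v \<le> 0"
proof (rule ccontr)
  assume "\<not> ?thesis"
  then have pos: "0 < a \<bullet> v" by simp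
  define t where "t = (c - a \<bullet> p + 1) / (a \<bullet> v)"
  have "0 \<le> t" using assms(3)[OF assms(2)] pos by (simp add: t_def)
  then have "a \<bullet> (p + t *\<^sub>R v) \<le> c" using assms by (auto simp: recession_cone_def)
  then show False using pos by (simp add: t_def inner_add_right)
qed

text \<open>
No nonzero functional vanishes on a full-dimensional set, so for each one there is a point where it is
positive; the sum of these points is positive for all.
\<close>

lemma full_dimensional_cone_strict_direction:
  fixes X :: "'a::euclidean_space set"
  assumes "aff_dim X = int DIM('a)" and "finite I" and "\<And>i. i \<in> I \<Longrightarrow> g i \<noteq> 0"
    and "\<And>i v. \<lbrakk>i \<in> I; v \<in> X\<rbrakk> \<Longrightarrow> 0 \<le> g i \<bullet> v"
  obtains v where "\<And>i. i \<in> I \<Longrightarrow> 0 < g i \<bullet> v"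
proof -
  have "\<exists>v\<in>X. 0 < g i \<bullet> v" if i: "i \<in> I" for i
  proof (rule ccontr)
    assume "\<not> ?thesis"
    then have "X \<subseteq> {x. g i \<bullet> x = 0}" using assms(4)[OF i] by force
    then have "aff_dim X \<le> aff_dim {x. g i \<bullet> x = 0}" by (rule aff_dim_subset)
    then show False using assms(1) assms(3)[OF i] by (simp add: aff_dim_hyperplane)
  qed
  then obtain v where v: "\<And>i. i \<in> I \<Longrightarrow> v i \<in> X \<and> 0 < g i \<bullet> v i" by metis
  have "0 < g i \<bullet> (\<Sum>j\<in>I. v j)" if i: "i \<in> I" for i
    unfolding inner_sum_right using assms(2,4) v i by (intro sum_pos2[of I i]) auto
  then show ?thesis by (rule that)
qed

theorem theorem1p2:
  fixes K :: "(real ^ 'n) set"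
  assumes "polyhedron K"
    and "K \<noteq> {}"
    and "aff_dim K = int CARD('n)"
    and "\<And>F. F facet_of K \<Longrightarrow> \<not> bounded F"
    and "aff_dim (recession_cone K) = int CARD('n)"
  shows "\<exists>f :: real ^ 'n \<Rightarrow> real ^ 'n. polynomial_function f \<and> range f = rel_interior K"
proof -
  obtain H where H: "finite H" "K = affine hull K \<inter> \<Inter>H"
    "\<forall>h\<in>H. \<exists>a b. a \<noteq> 0 \<and> h = {x. a \<bullet> x \<le> b}"
    "\<And>H'. H' \<subset> H \<Longrightarrow> K \<subset> affine hull K \<inter> \<Inter>H'"
    using assms(1) unfolding polyhedron_Int_affine_minimal by metis
  then obtain a b where ab: "\<And>h. h \<in> H \<Longrightarrow> a h \<noteq> 0 \<and> h = {x. a h \<bullet> x \<le> b h}" by metis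
  obtain p where p: "p \<in> K" using assms(2) by blast
  have hull: "affine hull K = UNIV" using assms(3) aff_dim_eq_full[of K] by simp
  have K_le: "a h \<bullet> x \<le> b h" if "x \<in> K" "h \<in> H" for x h
    using H(2) ab[OF that(2)] that by blast
  interpret linear_inequalities H "\<lambda>h. - a h" b
    by standard (rule H(1))
  have chamber: "rel_interior K = chamber"
  proof -
    have "rel_interior K = {x \<in> K. \<forall>h\<in>H. a h \<bullet> x < b h}"
      by (rule rel_interior_polyhedron_explicit[OF H(1,2) ab H(4)])
    also have "\<dots> = {x. \<forall>h\<in>H. a h \<bullet> x < b h}"
      using H(2) ab unfolding hull by (blast intro: less_imp_le)
    finally show ?thesis by (simp add: chamber_def slack_def)
  qed
  obtain v where v: "\<And>h. h \<in> H \<Longrightarrow> 0 < - a h \<bullet> v"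
  proof (rule full_dimensional_cone_strict_direction[of "recession_cone K" H "\<lambda>h. - a h"])
    show "0 \<le> - a h \<bullet> v" if "h \<in> H" "v \<in> recession_cone K" for h v
      using recession_cone_inner_nonpos[OF that(2) p K_le] that(1) by simp
  qed (use assms(5) H(1) ab in auto)
  have w: "\<exists>w. w \<noteq> 0 \<and> - a h \<bullet> w = 0 \<and> (\<forall>k\<in>H. 0 \<le> - a k \<bullet> w)" if h: "h \<in> H" for h
  proof -
    define F where "F = K \<inter> {x. a h \<bullet> x = b h}"
    have "F facet_of K"
      using facet_of_polyhedron_explicit[OF H(1,2) ab H(4)] h by (auto simp: F_def)
    then have unbounded: "\<not> bounded F" by (rule assms(4))
    \<comment> \<open>The facet also satisfies the reversed inequality of \<open>h\<close>, recorded under the index \<open>None\<close>; it forces equality in direction \<open>w\<close>.\<close>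
    define g' where "g' j = (case j of None \<Rightarrow> a h | Some k \<Rightarrow> - a k)" for j
    define b' where "b' j = (case j of None \<Rightarrow> - b h | Some k \<Rightarrow> b k)" for j
    have "0 \<le> g' j \<bullet> x + b' j" if "x \<in> F" "j \<in> insert None (Some ` H)" for x j
      using that K_le[of x] by (auto simp: F_def g'_def b'_def)
    then obtain w where w: "w \<noteq> 0" "\<And>j. j \<in> insert None (Some ` H) \<Longrightarrow> 0 \<le> g' j \<bullet> w"
      using unbounded_polyhedron_direction[OF unbounded, of "insert None (Some ` H)" g' b'] by blast
    have "0 \<le> a h \<bullet> w" "\<forall>k\<in>H. 0 \<le> - a k \<bullet> w"
      using w(2)[of None] w(2)[of "Some _"] by (auto simp: g'_def)
    then show ?thesis using w(1) h by force
  qed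
  show ?thesis unfolding chamber by (rule chamber_is_polynomial_image[OF v w])
qed

end
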